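(* Let $\mathbf U=(D,\mathbf m^\top,\mathbf B^\top,E)^\top\in\mathcal G$. Consider either (A) the $\gamma$-law equation of state with $\gamma\in(1,2]$, or (B) a general equation of state $h=\mathcal H(\rho,p)$ satisfying conditions (i)--(iv) of the context and such that either $\mathcal F'$ is monotone on $\Omega_2=(\xi_b,+\infty)$, or there is an inflection point $\xi_{in}\in\Omega_2$ such that $\mathcal F'$ is monotonically decreasing on $(\xi_b,\xi_{in}]$ and monotonically increasing on $[\xi_{in},+\infty)$. Suppose the initial guess $\xi_0$ is chosen in one of the following two ways: either $\xi_0=\xi_c$; or $\xi_0=\xi_d$ if $\mathcal F(\xi_d)\le0$ and $\xi_0=\xi_c$ otherwise. Then the Newton--Raphson iteration $\xi_{n+1}=\xi_n-\mathcal F(\xi_n)/\mathcal F'(\xi_n)$, $n=0,1,2,\dots$, is physical-constraint-preserving (PCP), that is, for all $n\ge0$ $$\xi_n\in\Omega_1,\quad\rho(\xi_n)>0,\quad p(\xi_n)>0,\quad|\mathbf v(\xi_n)|<1,$$ and it is convergent, that is, $\lim_{n\to\infty}\xi_n=\xi_*$, exhibiting a quadratic convergence rate.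
   Context: Conservative vectors are $\mathbf U=(D,\mathbf m^\top,\mathbf B^\top,E)^\top$ with $D,E\in\mathbb R$ and $\mathbf m,\mathbf B\in\mathbb R^3$. Write $m=|\mathbf m|$, $B=|\mathbf B|$, $\tau=\mathbf m\cdot\mathbf B$. The admissible set $\mathcal G$ is the set of all $\mathbf U$ with $D>0$, $E-\sqrt{D^2+m^2}>0$ and $\Psi(\mathbf U)>0$, where $$\Phi(\mathbf U)=\sqrt{(B^2-E)^2+3(E^2-D^2-m^2)},$$ $$\Psi(\mathbf U)=\big(\Phi(\mathbf U)-2(B^2-E)\big)\sqrt{\Phi(\mathbf U)+B^2-E}-\sqrt{\tfrac{27}{2}(D^2B^2+\tau^2)}.$$ Equation of state: $h=\mathcal H(\rho,p)$ for $\rho,p>0$, where (i) $\mathcal H$ is differentiable on $\mathbb R^+\times\mathbb R^+$; (ii) $\mathcal H(\rho,p)\ge\sqrt{1+p^2/\rho^2}+p/\rho$ for all $p,\rho>0$; (iii) $\mathcal H(\rho,p)\big(\frac1\rho-\frac{\partial\mathcal H}{\partial p}(\rho,p)\big)<\frac{\partial\mathcal H}{\partial\rho}(\rho,p)<0$ for all $p,\rho>0$; (iv) $\lim_{p\to0^+}\mathcal H(\rho,p)=1$ for all $\rho>0$. It is assumed that the equation of state can be rewritten as $p=\mathcal P(\rho,h)$: for every $\rho>0$ and $h>1$, $\mathcal P(\rho,h)$ is the unique $p>0$ with $\mathcal H(\rho,p)=h$. No positive pressure corresponds to $h\le1$, so "$\mathcal P(\rho,h)>0$" is understood to be false when $h\le1$.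 The $\gamma$-law equation of state is $\mathcal H(\rho,p)=1+\frac{\gamma p}{(\gamma-1)\rho}$, i.e. $\mathcal P(\rho,h)=\frac{\gamma-1}{\gamma}\rho(h-1)$. Define $$f_a(\xi)=\xi^2(\xi+B^2)^2-\big(\xi^2m^2+(2\xi+B^2)\tau^2\big),\qquad f_b(\xi)=f_a(\xi)-D^2(\xi+B^2)^2.$$ For $\mathbf U\in\mathcal G$ it is known that $f_a$ has at least one non-negative root. Let $\xi_a$ be its largest non-negative root; then $\Omega_1:=\{\xi>0:f_a(\xi)>0\}=(\xi_a,+\infty)$. It is known that $f_b$ has a unique root $\xi_b$ in $\Omega_1$; put $\Omega_2:=(\xi_b,+\infty)$. Let $$\mathcal W(\xi)=\frac{\xi(\xi+B^2)}{\sqrt{f_a(\xi)}},\qquad \mathcal F(\xi)=\xi-\mathcal P\Big(\frac{D}{\mathcal W(\xi)},\frac{\xi}{D\mathcal W(\xi)}\Big)-\frac12\Big(\frac{B^2}{\mathcal W(\xi)^2}+\frac{\tau^2}{\xi^2}\Big)+B^2-E.$$ On $\Omega_2$ one has $\xi/(D\mathcal W(\xi))>1$. It is known that $\mathcal F'>0$ on $\Omega_2$ and that $\mathcal F$ has a unique root in $\Omega_2$, denoted $\xi_*$. For $\xi\in\Omega_1$ define $\mathbf v(\xi)=\frac{\mathbf m+\xi^{-1}\tau\mathbf B}{\xi+B^2}$, $\rho(\xi)=\frac{D}{\mathcal W(\xi)}$, $h(\xi)=\frac{\xi}{D\mathcal W(\xi)}$, $p(\xi)=\mathcal P(\rho(\xi),h(\xi))$.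 Initial values: $\xi_d:=\frac13\big(\Phi(\mathbf U)-2(B^2-E)\big)$, and $\xi_c$ is the positive root (known to be unique for $\mathbf U\in\mathcal G$) of the cubic polynomial $f_c(\xi)=\xi^3+(B^2-E)\xi^2-\frac{B^2D^2+\tau^2}{2}$.
   Formalization: In case (B) the quadratic convergence rate is claimed only when $\mathcal F'$ is differentiable at $\xi_*$, since for merely differentiable $\mathcal H$ the rate can fail (errors of order 3/2); PCP and convergence need no extra condition. *)

theory Defs
  imports "HOL-Analysis.Analysis"
begin

text \<open>Conservative vectors $U = (D, m, B, E)$ of special relativistic magnetohydrodynamics.\<close>

record conserved =
  dens :: real
  mom :: "real^3"
  mag :: "real^3"
  energy :: real

definition tau :: "conserved \<Rightarrow> real" where
  "tau U = mom U \<bullet> mag U"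

definition Phi :: "conserved \<Rightarrow> real" where
  "Phi U = sqrt (((norm (mag U))\<^sup>2 - energy U)\<^sup>2
                 + 3 * ((energy U)\<^sup>2 - (dens U)\<^sup>2 - (norm (mom U))\<^sup>2))"

text \<open>In the admissible set below every argument of \<^const>\<open>sqrt\<close> is nonnegative:
  the condition on the energy gives $\Phi > |B^2 - E|$.  The value of \<^const>\<open>sqrt\<close> at
  negative arguments therefore plays no role there.\<close>

definition Psi :: "conserved \<Rightarrow> real" where
  "Psi U = (Phi U - 2 * ((norm (mag U))\<^sup>2 - energy U))
             * sqrt (Phi U + (norm (mag U))\<^sup>2 - energy U)
           - sqrt (27 / 2 * ((dens U)\<^sup>2 * (norm (mag U))\<^sup>2 + (tau U)\<^sup>2))"

definition admissible :: "conserved set" where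
  "admissible = {U. dens U > 0
     \<and> energy U - sqrt ((dens U)\<^sup>2 + (norm (mom U))\<^sup>2) > 0
     \<and> Psi U > 0}"

text \<open>Equations of state $h = H(\rho, p)$; only the values at positive arguments matter.\<close>

definition general_eos :: "(real \<Rightarrow> real \<Rightarrow> real) \<Rightarrow> bool" where
  "general_eos H \<longleftrightarrow>
     (\<lambda>(\<rho>, p). H \<rho> p) differentiable_on ({0<..} \<times> {0<..})
   \<and> (\<forall>\<rho>>0. \<forall>p>0. H \<rho> p \<ge> sqrt (1 + p\<^sup>2 / \<rho>\<^sup>2) + p / \<rho>)
   \<and> (\<forall>\<rho>>0. \<forall>p>0. H \<rho> p * (1 / \<rho> - deriv (\<lambda>q. H \<rho> q) p) < deriv (\<lambda>r. H r p) \<rho>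
                    \<and> deriv (\<lambda>r. H r p) \<rho> < 0)
   \<and> (\<forall>\<rho>>0. ((\<lambda>p. H \<rho> p) \<longlongrightarrow> 1) (at_right 0))
   \<and> (\<forall>\<rho>>0. \<forall>h>1. \<exists>!p. p > 0 \<and> H \<rho> p = h)"

definition gamma_law :: "real \<Rightarrow> (real \<Rightarrow> real \<Rightarrow> real) \<Rightarrow> bool" where
  "gamma_law \<gamma> H \<longleftrightarrow> (\<forall>\<rho>>0. \<forall>p>0. H \<rho> p = 1 + \<gamma> * p / ((\<gamma> - 1) * \<rho>))"

text \<open>No positive pressure corresponds to $h \le 1$; the value $0$ there makes the statement
  that the pressure is positive false, as it should be.\<close>

definition pressure :: "(real \<Rightarrow> real \<Rightarrow> real) \<Rightarrow> real \<Rightarrow> real \<Rightarrow> real" where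
  "pressure H \<rho> h = (if h > 1 then (THE p. p > 0 \<and> H \<rho> p = h) else 0)"

definition f_a :: "conserved \<Rightarrow> real \<Rightarrow> real" where
  "f_a U \<xi> = \<xi>\<^sup>2 * (\<xi> + (norm (mag U))\<^sup>2)\<^sup>2
            - (\<xi>\<^sup>2 * (norm (mom U))\<^sup>2 + (2 * \<xi> + (norm (mag U))\<^sup>2) * (tau U)\<^sup>2)"

definition f_b :: "conserved \<Rightarrow> real \<Rightarrow> real" where
  "f_b U \<xi> = f_a U \<xi> - (dens U)\<^sup>2 * (\<xi> + (norm (mag U))\<^sup>2)\<^sup>2"

definition f_c :: "conserved \<Rightarrow> real \<Rightarrow> real" where
  "f_c U \<xi> = \<xi> ^ 3 + ((norm (mag U))\<^sup>2 - energy U) * \<xi>\<^sup>2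
            - ((norm (mag U))\<^sup>2 * (dens U)\<^sup>2 + (tau U)\<^sup>2) / 2"

definition Omega1 :: "conserved \<Rightarrow> real set" where
  "Omega1 U = {\<xi>. \<xi> > 0 \<and> f_a U \<xi> > 0}"

definition xi_b :: "conserved \<Rightarrow> real" where
  "xi_b U = (THE \<xi>. \<xi> \<in> Omega1 U \<and> f_b U \<xi> = 0)"

definition Omega2 :: "conserved \<Rightarrow> real set" where
  "Omega2 U = {xi_b U<..}"

definition lorentz :: "conserved \<Rightarrow> real \<Rightarrow> real" where
  "lorentz U \<xi> = \<xi> * (\<xi> + (norm (mag U))\<^sup>2) / sqrt (f_a U \<xi>)"

definition velocity :: "conserved \<Rightarrow> real \<Rightarrow> real^3" where
  "velocity U \<xi> = (1 / (\<xi> + (norm (mag U))\<^sup>2)) *\<^sub>R (mom U + (tau U / \<xi>) *\<^sub>R mag U)"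

definition rest_density :: "conserved \<Rightarrow> real \<Rightarrow> real" where
  "rest_density U \<xi> = dens U / lorentz U \<xi>"

definition enthalpy :: "conserved \<Rightarrow> real \<Rightarrow> real" where
  "enthalpy U \<xi> = \<xi> / (dens U * lorentz U \<xi>)"

definition pressure_at :: "(real \<Rightarrow> real \<Rightarrow> real) \<Rightarrow> conserved \<Rightarrow> real \<Rightarrow> real" where
  "pressure_at H U \<xi> = pressure H (rest_density U \<xi>) (enthalpy U \<xi>)"

definition F :: "(real \<Rightarrow> real \<Rightarrow> real) \<Rightarrow> conserved \<Rightarrow> real \<Rightarrow> real" where
  "F H U \<xi> = \<xi> - pressure_at H U \<xi>
             - 1 / 2 * ((norm (mag U))\<^sup>2 / (lorentz U \<xi>)\<^sup>2 + (tau U)\<^sup>2 / \<xi>\<^sup>2)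
             + (norm (mag U))\<^sup>2 - energy U"

definition xi_star :: "(real \<Rightarrow> real \<Rightarrow> real) \<Rightarrow> conserved \<Rightarrow> real" where
  "xi_star H U = (THE \<xi>. \<xi> \<in> Omega2 U \<and> F H U \<xi> = 0)"

definition xi_c :: "conserved \<Rightarrow> real" where
  "xi_c U = (THE \<xi>. \<xi> > 0 \<and> f_c U \<xi> = 0)"

definition xi_d :: "conserved \<Rightarrow> real" where
  "xi_d U = 1 / 3 * (Phi U - 2 * ((norm (mag U))\<^sup>2 - energy U))"

text \<open>$F'$ is monotone on $\Omega_2$, or it decreases up to an inflection point of $F$
  and increases from there on.\<close>

definition deriv_shape :: "(real \<Rightarrow> real \<Rightarrow> real) \<Rightarrow> conserved \<Rightarrow> bool" where
  "deriv_shape H U \<longleftrightarrow>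
     mono_on (Omega2 U) (deriv (F H U))
   \<or> antimono_on (Omega2 U) (deriv (F H U))
   \<or> (\<exists>\<xi>\<^sub>i\<in>Omega2 U. antimono_on {xi_b U<..\<xi>\<^sub>i} (deriv (F H U))
                     \<and> mono_on {\<xi>\<^sub>i..} (deriv (F H U)))"

text \<open>The rate needs more regularity than differentiability of $H$: with $F'$ merely
  Hoelder continuous at the root (which \<^const>\<open>general_eos\<close> permits) the errors can behave
  like $e_{n+1} \sim c e_n^{3/2}$.\<close>

definition quadratic_rate :: "(nat \<Rightarrow> real) \<Rightarrow> real \<Rightarrow> bool" where
  "quadratic_rate x L \<longleftrightarrow> (\<exists>C. \<forall>n. \<bar>x (Suc n) - L\<bar> \<le> C * \<bar>x n - L\<bar>\<^sup>2)"

end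

theory Submission
  imports Defs
begin

text \<open>Split \<open>|m|\<^sup>2 = \<alpha> + \<beta>\<close> into the parts parallel and orthogonal to the magnetic
  field.  With \<open>b = |B|\<^sup>2\<close> one gets \<open>|v|\<^sup>2 = \<alpha> / \<xi>\<^sup>2 + \<beta> / (\<xi> + b)\<^sup>2 = 1 - S(\<xi>)\<close>, so that
  \<open>\<Omega>\<^sub>1 = {S > 0}\<close> and \<open>\<Omega>\<^sub>2 = {\<xi>\<^sup>2 S > D\<^sup>2}\<close> are half-lines.  Reducing \<open>f\<^sub>b\<close> modulo
  \<open>f\<^sub>c\<close> shows \<open>\<xi>\<^sub>b < \<xi>\<^sub>c < \<xi>\<^sub>d\<close>, and \<open>F(\<xi>\<^sub>c) < 0\<close>, so the iteration starts in \<open>\<Omega>\<^sub>2\<close>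
  to the left of the root.  Newton's method for an increasing function whose derivative first
  decreases and then increases never leaves the half-line to the right of such a start and
  converges: the iterates increase as long as they stay below the root, and if they ever overshoot
  it they decrease to it from then on.  For the gamma law the second derivative of \<open>F\<close> has the
  sign of \<open>Y(\<xi>) - D\<close> for an explicit nondecreasing function \<open>Y\<close>, which gives the required shape
  of \<open>F'\<close>.\<close>

subsection \<open>Newton iteration with quasiconvex derivative\<close>

text \<open>The derivative may be discontinuous at \<open>L\<close>, so the recursion is not simply
  passed to the limit. Instead \<open>|f (x n)|\<close> is \<open>f' (x n)\<close> times the step
  length; the steps tend to zero while \<open>f' (x n)\<close> stays below \<open>M\<close>.\<close>

lemma newton_limit_is_root:
  fixes f f' :: "real \<Rightarrow> real"
  assumes lim: "x \<longlonglongrightarrow> L"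
    and cont: "isCont f L"
    and pos: "\<And>n. f' (x n) > 0"
    and bound: "\<And>n. f' (x n) \<le> M"
    and step: "\<And>n. x (Suc n) = x n - f (x n) / f' (x n)"
  shows "f L = 0"
proof -
  have "(\<lambda>n. x n - x (Suc n)) \<longlonglongrightarrow> L - L"
    by (intro tendsto_diff lim LIMSEQ_Suc)
  then have diff0: "(\<lambda>n. M * \<bar>x n - x (Suc n)\<bar>) \<longlonglongrightarrow> 0"
    by (auto intro: tendsto_mult_right_zero tendsto_rabs_zero)
  have "\<bar>f (x n)\<bar> \<le> M * \<bar>x n - x (Suc n)\<bar>" for n
  proof -
    have "\<bar>f (x n)\<bar> = f' (x n) * \<bar>x n - x (Suc n)\<bar>"
      using pos[of n] by (simp add: step abs_mult)
    also have "\<dots> \<le> M * \<bar>x n - x (Suc n)\<bar>"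
      by (intro mult_right_mono bound) simp
    finally show ?thesis .
  qed
  then have "(\<lambda>n. f (x n)) \<longlonglongrightarrow> 0"
    using diff0 by (rule_tac Lim_null_comparison) (auto intro: always_eventually)
  moreover have "(\<lambda>n. f (x n)) \<longlonglongrightarrow> f L"
    using cont lim by (rule isCont_tendsto_compose)
  ultimately show ?thesis
    using LIMSEQ_unique by blast
qed

text \<open>The shape condition is a form of quasiconvexity of \<open>f'\<close> that needs no named turning
  point, so that the monotone and the unimodal cases are treated alike.\<close>

lemma newton_converges:
  fixes f f' :: "real \<Rightarrow> real"
  assumes deriv: "\<And>y. y > l \<Longrightarrow> (f has_real_derivative f' y) (at y)"
    and pos: "\<And>y. y > l \<Longrightarrow> f' y > 0"
    and shape: "\<And>y. y > l \<Longrightarrow> antimono_on {l<..y} f' \<or> mono_on {y..} f'"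
    and root: "r > l" "f r = 0"
    and start: "x 0 > l" "x 0 \<le> r"
    and step: "\<And>n. x (Suc n) = x n - f (x n) / f' (x n)"
  shows "\<forall>n. x n \<ge> x 0" and "x \<longlonglongrightarrow> r"
proof -
  have mvt: "\<exists>z. u < z \<and> z < v \<and> f v - f u = (v - u) * f' z" if "l < u" "u < v" for u v
    using MVT2[of u v f f'] deriv that by (meson less_le_trans order_less_le_trans)
  have incr: "f u < f v" if "l < u" "u < v" for u v
    using mvt[OF that] pos that by (smt (verit) mult_pos_pos)
  have neg: "f u < 0" if "l < u" "u < r" for u using incr[OF that] root by simp
  have nonneg: "f u \<ge> 0" if "r \<le> u" for u
    using incr[of r u] root that by (cases "u = r") auto
  have up: "x n < x (Suc n)" if "l < x n" "x n < r" for n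
    using neg[OF that] pos[OF that(1)] by (simp add: step divide_less_0_iff)
  have down: "x (Suc n) \<le> x n" if "r \<le> x n" for n
    using nonneg[OF that] pos[of "x n"] that root by (simp add: step)
  have cont: "isCont f y" if "y > l" for y
    using deriv[OF that] by (rule DERIV_isCont)
  \<comment> \<open>Where \<open>f'\<close> increases, \<open>f\<close> is convex: the tangent at
    \<open>x n\<close> lies below \<open>f\<close>, so its zero cannot fall to the left of
    \<open>r\<close>.\<close>
  have stay: "r \<le> x (Suc n)" if conv: "mono_on {r..} f'" and "r \<le> x n" for n
  proof (cases "x n = r")
    case True then show ?thesis by (simp add: step root)
  next
    case False
    with that have lt: "r < x n" by simp
    obtain z where z: "r < z" "z < x n" "f (x n) - f r = (x n - r) * f' z"
      using mvt[OF root(1) lt] by blast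
    have "f' z \<le> f' (x n)" using conv z by (auto simp: mono_on_def)
    then have "f (x n) \<le> (x n - r) * f' (x n)"
      using z lt root by (simp add: mult_left_mono)
    then have "f (x n) / f' (x n) \<le> x n - r"
      using pos[of "x n"] lt root by (simp add: divide_le_eq)
    then show ?thesis by (simp add: step)
  qed
  show "\<forall>n. x n \<ge> x 0" and "x \<longlonglongrightarrow> r"
  proof -
    \<comment> \<open>Either the iterates stay below the root forever, or \<open>N\<close> is the
      first index that reaches or passes it.\<close>
    consider "\<And>n. x n < r" | N where "r \<le> x N" "\<And>n. n < N \<Longrightarrow> x n < r"
    proof (cases "\<exists>n. r \<le> x n")
      case True
      then show ?thesis
        using that(2)[of "LEAST n. r \<le> x n"] by (metis LeastI_ex not_le_imp_less not_less_Least)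
    next
      case False
      then show ?thesis using that(1) by (simp add: not_le)
    qed
    then have "(\<forall>n. x n \<ge> x 0) \<and> x \<longlonglongrightarrow> r"
    proof cases
      case 1
      have ge0: "x n \<ge> x 0" for n
      proof (induction n)
        case (Suc n)
        with up[of n] 1[of n] start show ?case by linarith
      qed simp
      then have gt: "x n > l" for n using start less_le_trans by blast
      have "incseq x" by (rule incseq_SucI) (use up gt 1 in \<open>simp add: less_imp_le\<close>)
      then obtain L where L: "x \<longlonglongrightarrow> L" "\<forall>n. x n \<le> L"
        using incseq_convergent[OF \<open>incseq x\<close>, of r] 1 less_imp_le by blast
      have "L > l" using L(2) gt less_le_trans by blast
      \<comment> \<open>The shape alternative at \<open>x n\<close> compares \<open>f' (x n)\<close>
        with the value at \<open>x 0\<close> if \<open>f'\<close> decreases up to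
        \<open>x n\<close>, and with the value at \<open>r\<close> if it increases from there
        on.\<close>
      have "f' (x n) \<le> max (f' (x 0)) (f' r)" for n
        using shape[OF gt[of n]] ge0[of n] start 1[of n]
        by (auto simp: monotone_on_def le_max_iff_disj)
      then have "f L = 0"
        by (intro newton_limit_is_root[OF L(1) cont[OF \<open>L > l\<close>] _ _ step]) (use pos gt in auto)
      then have "L = r"
        using incr[of L r] incr[of r L] root \<open>L > l\<close> by (metis less_irrefl linorder_neqE)
      then show ?thesis using L ge0 by simp
    next
      case 2
      have pre: "x n \<ge> x 0" if "n \<le> N" for n
        using that
      proof (induction n)
        case (Suc n)
        with up[of n] 2(2)[of n] start show ?case by force
      qed simp
      show ?thesis
      proof (cases "x N = r")
        case True
        have const: "x (N + k) = r" for k by (induction k) (simp_all add: True step root)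
        have "x n \<ge> x 0" for n
          using pre[of n] const[of "n - N"] start by (cases "n \<le> N") auto
        moreover have "x \<longlonglongrightarrow> r"
          using const by (intro LIMSEQ_offset[of x N]) (simp add: add.commute)
        ultimately show ?thesis by simp
      next
        case False
        then have gtN: "x N > r" using 2 by simp
        then obtain M where M: "N = Suc M" using start by (cases N) auto
        then have xM: "x M < r" "l < x M" using 2(2)[of M] pre[of M] start by auto
        \<comment> \<open>If \<open>f'\<close> decreased up to \<open>r\<close>, then
          \<open>f\<close> would be concave there, its tangent at \<open>x M\<close> would lie above
          \<open>f\<close>, and the step from \<open>x M\<close> could not pass \<open>r\<close>.
          Overshooting thus forces the increasing alternative at \<open>r\<close>.\<close>
        have "\<not> antimono_on {l<..r} f'"
        proof
          assume anti: "antimono_on {l<..r} f'"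
          obtain z where z: "x M < z" "z < r" "f r - f (x M) = (r - x M) * f' z"
            using mvt[OF xM(2,1)] by blast
          have "f' z \<le> f' (x M)" using anti z xM by (auto simp: monotone_on_def)
          then have "- f (x M) \<le> (r - x M) * f' (x M)"
            using z root xM mult_left_mono[of "f' z" "f' (x M)" "r - x M"] by simp
          then have "- f (x M) / f' (x M) \<le> r - x M"
            using pos[OF xM(2)] by (simp only: divide_le_eq) simp
          with gtN show False by (simp add: M step)
        qed
        then have conv: "mono_on {r..} f'" using shape[OF root(1)] by blast
        have ge: "r \<le> x (k + N)" for k
          by (induction k) (use gtN stay[OF conv] in auto)
        have dec: "decseq (\<lambda>k. x (k + N))"
          by (rule decseq_SucI) (use down ge in simp)
        then obtain L where L: "(\<lambda>k. x (k + N)) \<longlonglongrightarrow> L"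
          using decseq_convergent[of "\<lambda>k. x (k + N)" r] ge by blast
        have "L \<ge> r" using L ge by (meson LIMSEQ_le_const)
        have "f' (x (k + N)) \<le> f' (x N)" for k
          using conv ge[of k] gtN decseqD[OF dec, of 0 k] by (auto simp: monotone_on_def)
        then have "f L = 0"
          using \<open>L \<ge> r\<close> root
          by (intro newton_limit_is_root[OF L cont, of f' "f' (x N)"])
             (auto simp: step intro!: pos less_le_trans[OF root(1) ge])
        then have "L = r" using incr[of r L] root \<open>L \<ge> r\<close> by force
        then have "x \<longlonglongrightarrow> r" using L by (auto intro: LIMSEQ_offset)
        moreover have "x n \<ge> x 0" for n
          using pre[of n] ge[of "n - N"] start by (cases "n \<le> N") auto
        ultimately show ?thesis by simp
      qed
    qed
    then show "\<forall>n. x n \<ge> x 0" and "x \<longlonglongrightarrow> r" by auto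
  qed
qed

text \<open>The mean value theorem gives
  \<open>x (Suc n) - r = (x n - r) * (f' (x n) - f' z) / f' (x n)\<close> with \<open>z\<close>
  between \<open>x n\<close> and \<open>r\<close>. Differentiability of \<open>f'\<close> at the
  single point \<open>r\<close> bounds the distance of \<open>f' (x n)\<close> and of
  \<open>f' z\<close> from \<open>f' r\<close> by a multiple of the error.\<close>

lemma newton_quadratic_rate:
  fixes f f' :: "real \<Rightarrow> real"
  assumes deriv: "\<And>y. y > l \<Longrightarrow> (f has_real_derivative f' y) (at y)"
    and diff: "f' differentiable (at r)" and "f' r > 0"
    and root: "r > l" "f r = 0"
    and lim: "x \<longlonglongrightarrow> r"
    and step: "\<And>n. x (Suc n) = x n - f (x n) / f' (x n)"
  shows "quadratic_rate x r"
proof -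
  obtain d where d: "(f' has_real_derivative d) (at r)"
    using diff by (auto simp: real_differentiable_def)
  have "\<forall>\<^sub>F y in at r. \<bar>(f' y - f' r) / (y - r)\<bar> < \<bar>d\<bar> + 1"
    using tendsto_rabs[OF d[unfolded has_field_derivative_iff]] by (rule order_tendstoD(2)) simp
  moreover have "\<forall>\<^sub>F y in at r. f' y > f' r / 2"
    using DERIV_isCont[OF d] \<open>f' r > 0\<close> by (intro order_tendstoD(1)[of f' "f' r"]) (auto simp: isCont_def)
  ultimately have "\<forall>\<^sub>F y in at r. \<bar>f' y - f' r\<bar> \<le> (\<bar>d\<bar> + 1) * \<bar>y - r\<bar> \<and> f' y > f' r / 2"
    using eventually_neq_at_within[of r r UNIV]
    by eventually_elim (auto simp: divide_simps abs_divide split: if_splits)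
  then obtain \<delta> where \<delta>: "\<delta> > 0"
    and near: "\<And>y. y \<noteq> r \<Longrightarrow> \<bar>y - r\<bar> < \<delta> \<Longrightarrow> \<bar>f' y - f' r\<bar> \<le> (\<bar>d\<bar> + 1) * \<bar>y - r\<bar> \<and> f' y > f' r / 2"
    by (auto simp: eventually_at dist_real_def)
  define \<epsilon> where "\<epsilon> = min \<delta> (r - l)"
  have \<epsilon>: "\<epsilon> > 0" "\<epsilon> \<le> \<delta>" "\<epsilon> \<le> r - l" using \<delta> root by (auto simp: \<epsilon>_def)
  \<comment> \<open>One factor 2 comes from the two differences to \<open>f' r\<close>, the other
    from \<open>f' (x n) > f' r / 2\<close>.\<close>
  define K where "K = 4 * (\<bar>d\<bar> + 1) / f' r"
  have local: "\<bar>x (Suc n) - r\<bar> \<le> K * \<bar>x n - r\<bar>\<^sup>2" if "\<bar>x n - r\<bar> < \<epsilon>" for n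
  proof (cases "x n = r")
    case True
    then show ?thesis by (simp add: step root)
  next
    case False
    define e where "e = \<bar>x n - r\<bar>"
    have gt: "y > l" if "\<bar>y - r\<bar> \<le> e" for y
      using that \<open>\<bar>x n - r\<bar> < \<epsilon>\<close> \<epsilon> unfolding e_def by linarith
    obtain z where z: "\<bar>z - r\<bar> < e" "z \<noteq> r" "f (x n) - f r = (x n - r) * f' z"
    proof (cases "x n < r")
      case True
      then obtain z where "x n < z" "z < r" "f r - f (x n) = (r - x n) * f' z"
        using MVT2[of "x n" r f f'] deriv gt by (force simp: e_def)
      then show ?thesis by (intro that[of z]) (auto simp: e_def algebra_simps)
    next
      case False
      with \<open>x n \<noteq> r\<close> have "r < x n" by simp
      then obtain z where "r < z" "z < x n" "f (x n) - f r = (x n - r) * f' z"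
        using MVT2[of r "x n" f f'] deriv gt by (force simp: e_def)
      then show ?thesis by (intro that[of z]) (auto simp: e_def)
    qed
    have nz: "\<bar>f' z - f' r\<bar> \<le> (\<bar>d\<bar> + 1) * e"
      using near[OF z(2)] z(1) that \<epsilon> mult_left_mono[of "\<bar>z - r\<bar>" e "\<bar>d\<bar> + 1"]
      by (auto simp: e_def)
    have nx: "\<bar>f' (x n) - f' r\<bar> \<le> (\<bar>d\<bar> + 1) * e" "f' (x n) > f' r / 2"
      using near[OF False] that \<epsilon> by (auto simp: e_def)
    have px: "f' (x n) > 0" using nx \<open>f' r > 0\<close> by linarith
    have "x (Suc n) - r = (x n - r) * (f' (x n) - f' z) / f' (x n)"
      using z(3) root px by (simp add: step field_simps)
    then have "\<bar>x (Suc n) - r\<bar> = e * \<bar>f' (x n) - f' z\<bar> / f' (x n)"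
      using px by (simp add: e_def abs_mult)
    also have "\<dots> \<le> e * (2 * ((\<bar>d\<bar> + 1) * e)) / (f' r / 2)"
      using nx nz \<open>f' r > 0\<close> abs_triangle_ineq4[of "f' (x n) - f' r" "f' z - f' r"]
      by (intro frac_le mult_left_mono) (auto simp: e_def)
    also have "\<dots> = K * e\<^sup>2"
      by (simp add: K_def power2_eq_square field_simps)
    finally show ?thesis by (simp add: e_def)
  qed
  obtain N where N: "\<And>n. n \<ge> N \<Longrightarrow> \<bar>x n - r\<bar> < \<epsilon>"
    using LIMSEQ_D[OF lim \<epsilon>(1)] by auto
  \<comment> \<open>Each of the finitely many indices before the local estimate applies contributes
    its own ratio. If \<open>x n = r\<close>, the ratio is \<open>0\<close> through division by
    zero, and the next error vanishes too.\<close>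
  define C where "C = K + (\<Sum>n<N. \<bar>x (Suc n) - r\<bar> / \<bar>x n - r\<bar>\<^sup>2)"
  have "K \<ge> 0" using \<open>f' r > 0\<close> by (simp add: K_def)
  have "\<bar>x (Suc n) - r\<bar> \<le> C * \<bar>x n - r\<bar>\<^sup>2" for n
  proof (cases "n < N")
    case True
    show ?thesis
    proof (cases "x n = r")
      case True
      then show ?thesis by (simp add: step root)
    next
      case False
      have "\<bar>x (Suc n) - r\<bar> / \<bar>x n - r\<bar>\<^sup>2 \<le> C"
        using member_le_sum[of n "{..<N}" "\<lambda>n. \<bar>x (Suc n) - r\<bar> / \<bar>x n - r\<bar>\<^sup>2"] True \<open>K \<ge> 0\<close>
        by (auto simp: C_def)
      then show ?thesis using False by (simp add: divide_simps split: if_splits)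
    qed
  next
    case False
    have "K \<le> C" by (auto simp: C_def intro!: sum_nonneg)
    have "\<bar>x (Suc n) - r\<bar> \<le> K * \<bar>x n - r\<bar>\<^sup>2" using False N by (intro local) auto
    also have "\<dots> \<le> C * \<bar>x n - r\<bar>\<^sup>2" by (intro mult_right_mono \<open>K \<le> C\<close>) simp
    finally show ?thesis .
  qed
  then show ?thesis by (auto simp: quadratic_rate_def)
qed

subsection \<open>Orthogonal splitting of the momentum\<close>

text \<open>Describing \<alpha> and \<beta> by equations instead of formulas avoids division by
  \<open>norm (mag U)\<close>, so a vanishing magnetic field is covered as well.\<close>

locale orthogonal_split =
  fixes U :: conserved and \<alpha> \<beta> :: real
  assumes adm: "U \<in> admissible"
    and split_nonneg: "\<alpha> \<ge> 0" "\<beta> \<ge> 0"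
    and split_tau: "(tau U)\<^sup>2 = \<alpha> * (norm (mag U))\<^sup>2"
    and split_mom: "(norm (mom U))\<^sup>2 = \<alpha> + \<beta>"
begin

abbreviation D :: real where "D \<equiv> dens U"
abbreviation E :: real where "E \<equiv> energy U"
abbreviation b :: real where "b \<equiv> (norm (mag U))\<^sup>2"

definition S :: "real \<Rightarrow> real" where
  "S x = 1 - \<alpha> / x\<^sup>2 - \<beta> / (x + b)\<^sup>2"

lemma xb_pos: "x > 0 \<Longrightarrow> x + b > 0"
  and xb_neq_0: "x > 0 \<Longrightarrow> x + b \<noteq> 0"
  using zero_le_power2[of "norm (mag U)"] by linarith+

lemma adm_simps: "D > 0" "E > sqrt (D\<^sup>2 + \<alpha> + \<beta>)" "Psi U > 0"
  using adm by (auto simp: admissible_def split_mom add.assoc)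

lemma energy_pos: "E > 0"
proof -
  have "0 \<le> sqrt (D\<^sup>2 + \<alpha> + \<beta>)" using split_nonneg by simp
  then show ?thesis using adm_simps(2) by linarith
qed

lemma energy_sq: "D\<^sup>2 + \<alpha> + \<beta> < E\<^sup>2"
proof -
  have "(sqrt (D\<^sup>2 + \<alpha> + \<beta>))\<^sup>2 < E\<^sup>2"
    using adm_simps(2) split_nonneg by (intro power_strict_mono) simp_all
  then show ?thesis using split_nonneg by simp
qed

text \<open>By \<open>split_tau\<close>, \<open>\<alpha> * (x + b)\<^sup>2 = \<alpha> * x\<^sup>2 +
  (2 * x + b) * (tau U)\<^sup>2\<close>.\<close>

lemma f_a_eq: "x > 0 \<Longrightarrow> f_a U x = (x * (x + b))\<^sup>2 * S x"
proof -
  assume x: "x > 0"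
  have [simp]: "x + b \<noteq> 0" "x \<noteq> 0" using x xb_neq_0 by auto
  have "(x * (x + b))\<^sup>2 * S x = (x * (x + b))\<^sup>2 - \<alpha> * (x + b)\<^sup>2 - \<beta> * x\<^sup>2"
    unfolding S_def power_mult_distrib right_diff_distrib by simp
  then show ?thesis
    unfolding f_a_def split_tau split_mom by algebra
qed

lemma f_b_eq: "x > 0 \<Longrightarrow> f_b U x = (x + b)\<^sup>2 * (x\<^sup>2 * S x - D\<^sup>2)"
  unfolding f_b_def f_a_eq power_mult_distrib by algebra

lemma Omega1_iff: "x \<in> Omega1 U \<longleftrightarrow> x > 0 \<and> S x > 0"
proof (cases "x > 0")
  case True
  then have "(x * (x + b))\<^sup>2 > 0" using xb_neq_0 by simp
  then show ?thesis using True by (auto simp: Omega1_def f_a_eq zero_less_mult_iff)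
qed (simp add: Omega1_def)

lemma S_mono: "0 < x \<Longrightarrow> x \<le> y \<Longrightarrow> S x \<le> S y"
proof -
  assume xy: "0 < x" "x \<le> y"
  then have "\<alpha> / y\<^sup>2 \<le> \<alpha> / x\<^sup>2" "\<beta> / (y + b)\<^sup>2 \<le> \<beta> / (x + b)\<^sup>2"
    using split_nonneg xb_pos[of x] xb_pos[of y]
    by (auto intro!: divide_left_mono power_mono mult_pos_pos zero_less_power simp del: power2_eq_square)
  then show ?thesis by (simp add: S_def)
qed

lemma S_le_1: "S x \<le> 1"
proof -
  have "\<alpha> / x\<^sup>2 \<ge> 0" "\<beta> / (x + b)\<^sup>2 \<ge> 0" using split_nonneg by simp_all
  then show ?thesis by (simp add: S_def)
qed

lemma x2S_strict_mono: "0 < x \<Longrightarrow> x < y \<Longrightarrow> S x > 0 \<Longrightarrow> x\<^sup>2 * S x < y\<^sup>2 * S y"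
  using S_mono[of x y] by (intro mult_less_le_imp_less power_strict_mono) auto

lemma lorentz_eq: "x \<in> Omega1 U \<Longrightarrow> lorentz U x = 1 / sqrt (S x)"
  using xb_pos[of x]
  by (simp add: Omega1_iff lorentz_def f_a_eq real_sqrt_mult)

lemma norm_velocity: "x > 0 \<Longrightarrow> (norm (velocity U x))\<^sup>2 = 1 - S x"
proof -
  assume x: "x > 0"
  have [simp]: "x + b \<noteq> 0" "x \<noteq> 0" using x xb_neq_0 by auto
  have "(norm (mom U + (tau U / x) *\<^sub>R mag U))\<^sup>2
      = (norm (mom U))\<^sup>2 + 2 * (tau U)\<^sup>2 / x + (tau U)\<^sup>2 / x\<^sup>2 * b"
    by (simp add: power2_norm_eq_inner inner_add_left inner_add_right tau_def inner_commute
        power2_eq_square[of "inner _ _"] power2_eq_square[of x])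
  also have "\<dots> = (x + b)\<^sup>2 * (1 - S x)"
    unfolding S_def split_tau split_mom by (simp add: divide_simps) algebra
  finally show ?thesis
    by (simp add: velocity_def power_mult_distrib power_divide)
qed

text \<open>On \<open>Omega1 U\<close> the roots of \<open>f_b\<close> are the solutions of
  \<open>x\<^sup>2 * S x = D\<^sup>2\<close>, whose left side is strictly increasing where
  \<open>S\<close> is positive. The intermediate value theorem gives existence, monotonicity the
  rest.\<close>

lemma xi_b_characterization: "\<exists>l>0. xi_b U = l \<and> (\<forall>x. x > l \<longleftrightarrow> x > 0 \<and> x\<^sup>2 * S x > D\<^sup>2)"
proof -
  \<comment> \<open>A right end for the intermediate value theorem: \<open>X\<^sup>2 * S X =
    D\<^sup>2 + \<beta> - \<beta> * X\<^sup>2 / (X + b)\<^sup>2\<close>, which is at least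
    \<open>D\<^sup>2\<close>. At the left end \<open>D\<close> the bound \<open>S D \<le> 1\<close>
    suffices.\<close>
  define X where "X = sqrt (D\<^sup>2 + \<alpha> + \<beta>)"
  have X: "D \<le> X" "X\<^sup>2 = D\<^sup>2 + \<alpha> + \<beta>"
    using adm_simps split_nonneg by (auto simp: X_def intro!: real_le_rsqrt)
  have low: "D\<^sup>2 * S D \<le> D\<^sup>2" using S_le_1 by (simp add: mult_left_le)
  have "\<beta> * (X\<^sup>2 / (X + b)\<^sup>2) \<le> \<beta>"
    using split_nonneg X(1) adm_simps(1)
    by (intro mult_left_le) (auto simp: divide_le_eq simp del: X(2) intro!: power_mono)
  then have high: "D\<^sup>2 \<le> X\<^sup>2 * S X"
    using X adm_simps(1) split_nonneg by (simp add: S_def right_diff_distrib mult.commute[of \<beta>])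
  have "continuous_on {D..X} (\<lambda>x. x\<^sup>2 * S x)"
    unfolding S_def using adm_simps(1) xb_neq_0
    by (intro continuous_intros) auto
  then obtain l where l: "D \<le> l" "l\<^sup>2 * S l = D\<^sup>2"
    using IVT'[of "\<lambda>x. x\<^sup>2 * S x", OF low high X(1)] by blast
  have "l > 0" using l adm_simps by linarith
  have S_pos: "S x > 0" if "x\<^sup>2 * S x \<ge> D\<^sup>2" for x
    using less_le_trans[OF zero_less_power[OF adm_simps(1)] that] by (simp add: zero_less_mult_iff)
  have iff: "x > l \<longleftrightarrow> x > 0 \<and> x\<^sup>2 * S x > D\<^sup>2" for x
  proof
    assume "x > l"
    then show "x > 0 \<and> x\<^sup>2 * S x > D\<^sup>2"
      using x2S_strict_mono[of l x] S_pos[of l] l \<open>l > 0\<close> by simp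
  next
    assume x: "x > 0 \<and> x\<^sup>2 * S x > D\<^sup>2"
    then have "\<not> x < l" "x \<noteq> l"
      using x2S_strict_mono[of x l] S_pos[of x] l by auto
    then show "x > l" by simp
  qed
  have "xi_b U = l"
    unfolding xi_b_def
  proof (rule the_equality)
    show "l \<in> Omega1 U \<and> f_b U l = 0"
      using S_pos[of l] l \<open>l > 0\<close> by (simp add: Omega1_iff f_b_eq)
  next
    fix x assume "x \<in> Omega1 U \<and> f_b U x = 0"
    then have "x > 0" "x\<^sup>2 * S x = D\<^sup>2" "S x > 0"
      using xb_neq_0[of x] by (auto simp: Omega1_iff f_b_eq)
    then have "\<not> x < l" "\<not> l < x"
      using x2S_strict_mono[of x l] x2S_strict_mono[of l x] S_pos[of l] l \<open>l > 0\<close> by auto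
    then show "x = l" by simp
  qed
  then show ?thesis using iff \<open>l > 0\<close> by blast
qed

lemma Omega2_iff: "x \<in> Omega2 U \<longleftrightarrow> x > 0 \<and> x\<^sup>2 * S x > D\<^sup>2"
proof -
  obtain l where l: "l > 0" "xi_b U = l" "\<And>x. x > l \<longleftrightarrow> x > 0 \<and> x\<^sup>2 * S x > D\<^sup>2"
    using xi_b_characterization by blast
  show "x \<in> Omega2 U \<longleftrightarrow> x > 0 \<and> x\<^sup>2 * S x > D\<^sup>2"
    unfolding Omega2_def l(2) greaterThan_iff by (rule l(3))
qed

lemma Omega2_simps:
  assumes "x \<in> Omega2 U"
  shows "x > 0" "S x > 0" "x + b > 0" "x \<in> Omega1 U" "D < x * sqrt (S x)"
proof -
  show x: "x > 0" and "x + b > 0" using assms xb_pos by (auto simp: Omega2_iff)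
  have *: "D\<^sup>2 < x\<^sup>2 * S x" using assms by (simp add: Omega2_iff)
  have "0 < x\<^sup>2 * S x" using zero_le_power2 * by (rule le_less_trans)
  then show S: "S x > 0" using x zero_less_mult_pos by fastforce
  then show "x \<in> Omega1 U" using x by (simp add: Omega1_iff)
  show "D < x * sqrt (S x)"
  proof (rule power2_less_imp_less)
    show "D\<^sup>2 < (x * sqrt (S x))\<^sup>2" using * S by (simp add: power_mult_distrib)
  qed (use x S in simp)
qed

lemma rest_density_eq: "x \<in> Omega1 U \<Longrightarrow> rest_density U x = D * sqrt (S x)"
  and enthalpy_eq: "x \<in> Omega1 U \<Longrightarrow> enthalpy U x = x * sqrt (S x) / D"
  by (simp_all add: rest_density_def enthalpy_def lorentz_eq)

lemma rest_density_pos: "x \<in> Omega2 U \<Longrightarrow> rest_density U x > 0"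
  and enthalpy_gt_1: "x \<in> Omega2 U \<Longrightarrow> enthalpy U x > 1"
  using Omega2_simps[of x] adm_simps by (simp_all add: rest_density_eq enthalpy_eq)

text \<open>The \<alpha> term of \<open>b * S x\<close> cancels against
  \<open>(tau U)\<^sup>2 / x\<^sup>2\<close>, so only the \<beta> term of the magnetic part
  survives.\<close>

lemma F_eq:
  assumes "x \<in> Omega1 U"
  shows "F H U x = x - pressure_at H U x + b / 2 - E + b * \<beta> / (2 * (x + b)\<^sup>2)"
proof -
  have "x > 0" "S x > 0" using assms by (auto simp: Omega1_iff)
  then have [simp]: "x + b \<noteq> 0" "x \<noteq> 0" using xb_neq_0 by auto
  have "b / (lorentz U x)\<^sup>2 = b * S x"
    using assms \<open>S x > 0\<close> by (simp add: lorentz_eq power_divide)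
  then show ?thesis
    by (simp add: F_def split_tau S_def field_simps)
qed

end

subsection \<open>Initial values\<close>

context orthogonal_split
begin

lemma Phi_gt: "\<bar>b - E\<bar> < Phi U"
  unfolding Phi_def split_mom using energy_sq
  by (intro real_less_rsqrt) (simp add: power2_abs)

lemma Phi_sq: "(Phi U)\<^sup>2 = (b - E)\<^sup>2 + 3 * (E\<^sup>2 - D\<^sup>2 - (\<alpha> + \<beta>))"
  unfolding Phi_def split_mom using energy_sq
  by (intro real_sqrt_pow2) (simp add: add_nonneg_nonneg)

lemma f_c_eq: "f_c U x = x\<^sup>2 * (x + b - E) - b * (D\<^sup>2 + \<alpha>) / 2"
  unfolding f_c_def split_tau by (simp add: power2_eq_square power3_eq_cube algebra_simps)

lemma xi_d_3: "3 * xi_d U = Phi U - 2 * (b - E)"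
  by (simp add: xi_d_def)

text \<open>\<open>Psi U > 0\<close> makes the product of \<open>xi_d U\<close> with a square root
  positive, and \<open>3 * (xi_d U + b - E) = Phi U + b - E\<close>. The second bound puts
  \<open>xi_d U\<close> where \<open>f_c\<close> increases.\<close>

lemma xi_d_gt: "xi_d U > 0" "xi_d U + b - E > 0"
proof -
  have "sqrt (27 / 2 * (D\<^sup>2 * b + (tau U)\<^sup>2)) < 3 * xi_d U * sqrt (Phi U + b - E)"
    using adm_simps(3) unfolding xi_d_3 Psi_def by simp
  moreover have "0 \<le> sqrt (27 / 2 * (D\<^sup>2 * b + (tau U)\<^sup>2))" by simp
  ultimately have "0 < 3 * xi_d U * sqrt (Phi U + b - E)" by linarith
  then show "xi_d U > 0"
    using Phi_gt by (auto simp: zero_less_mult_iff)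
  show "xi_d U + b - E > 0"
    using Phi_gt by (simp add: xi_d_def field_simps)
qed

text \<open>The condition \<open>\<Psi> > 0\<close> is, up to squaring, exactly the positivity of the cubic at
  \<open>\<xi>\<^sub>d\<close>.\<close>

lemma f_c_xi_d_pos: "f_c U (xi_d U) > 0"
proof -
  have eq: "Phi U + b - E = 3 * (xi_d U + b - E)" by (simp add: xi_d_def field_simps)
  have "sqrt (27 / 2 * (D\<^sup>2 * b + (tau U)\<^sup>2)) < 3 * xi_d U * sqrt (3 * (xi_d U + b - E))"
    using adm_simps(3) unfolding xi_d_3 Psi_def eq by simp
  then have "(sqrt (27 / 2 * (D\<^sup>2 * b + (tau U)\<^sup>2)))\<^sup>2 < (3 * xi_d U * sqrt (3 * (xi_d U + b - E)))\<^sup>2"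
    by (intro power_strict_mono) simp_all
  then have "27 / 2 * (D\<^sup>2 * b + (tau U)\<^sup>2) < 9 * (xi_d U)\<^sup>2 * (3 * (xi_d U + b - E))"
    using xi_d_gt by (simp add: power_mult_distrib)
  then show ?thesis by (simp add: f_c_eq split_tau field_simps)
qed

lemma f_c_strict_mono:
  assumes "0 < x" "x < y" "x + b - E \<ge> 0"
  shows "f_c U x < f_c U y"
proof -
  have "x\<^sup>2 * (x + b - E) \<le> y\<^sup>2 * (x + b - E)"
    using assms by (intro mult_right_mono power_mono) auto
  also have "\<dots> < y\<^sup>2 * (y + b - E)" using assms by (intro mult_strict_left_mono) auto
  finally show ?thesis by (simp add: f_c_eq)
qed

text \<open>At a root, \<open>x\<^sup>2 * (x + b - E)\<close> equals a nonnegative constant. With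
  \<open>f_c_strict_mono\<close> this leaves room for only one positive root.\<close>

lemma f_c_root_ge:
  assumes "x > 0" "f_c U x = 0"
  shows "x + b - E \<ge> 0"
proof -
  have "x\<^sup>2 * (x + b - E) = b * (D\<^sup>2 + \<alpha>) / 2" using assms by (simp add: f_c_eq)
  also have "\<dots> \<ge> 0" using split_nonneg by simp
  finally show ?thesis using assms by (simp add: zero_le_mult_iff)
qed

lemma xi_c_root: "xi_c U > 0" "f_c U (xi_c U) = 0"
proof -
  \<comment> \<open>At this point \<open>y\<^sup>2 * (y + b - E)\<close> vanishes and only the
    nonpositive constant of the cubic remains.\<close>
  define y where "y = max 0 (E - b)"
  have "f_c U y = - (b * (D\<^sup>2 + \<alpha>) / 2)" by (auto simp: f_c_eq y_def max_def)
  moreover have "b * (D\<^sup>2 + \<alpha>) \<ge> 0" using split_nonneg by simp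
  ultimately have low: "f_c U y \<le> 0" by simp
  have "y \<le> xi_d U" using xi_d_gt by (simp add: y_def)
  moreover have "continuous_on {y..xi_d U} (f_c U)"
    unfolding f_c_eq[abs_def] by (intro continuous_intros)
  ultimately obtain z where z: "y \<le> z" "f_c U z = 0"
    using IVT'[of "f_c U" y 0 "xi_d U"] low f_c_xi_d_pos by auto
  \<comment> \<open>A root at zero would force \<open>b = 0\<close>, and then
    \<open>z \<ge> y = E > 0\<close>.\<close>
  have "z \<noteq> 0"
  proof
    assume "z = 0"
    then have "b * (D\<^sup>2 + \<alpha>) = 0" using z(2) by (simp add: f_c_eq)
    moreover have "D\<^sup>2 + \<alpha> > 0" using adm_simps split_nonneg by (simp add: add_pos_nonneg)
    ultimately have "b = 0" by simp
    then show False using z(1) \<open>z = 0\<close> energy_pos by (simp add: y_def)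
  qed
  then have "z > 0" using z(1) by (simp add: y_def)
  have "\<exists>!x. x > 0 \<and> f_c U x = 0"
  proof (rule ex1I[of _ z])
    fix x assume x: "x > 0 \<and> f_c U x = 0"
    then have "\<not> x < z" "\<not> z < x"
      using f_c_strict_mono[of x z] f_c_strict_mono[of z x] f_c_root_ge z \<open>z > 0\<close> by auto
    then show "x = z" by simp
  qed (use z \<open>z > 0\<close> in simp)
  then show "xi_c U > 0" "f_c U (xi_c U) = 0"
    unfolding xi_c_def by (metis (mono_tags, lifting) theI')+
qed

lemma xi_c_less_xi_d: "xi_c U < xi_d U"
proof (rule ccontr)
  assume "\<not> xi_c U < xi_d U"
  then have "f_c U (xi_d U) \<le> f_c U (xi_c U)"
    using f_c_strict_mono[of "xi_d U" "xi_c U"] xi_d_gt by fastforce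
  then show False using f_c_xi_d_pos xi_c_root by simp
qed

text \<open>Modulo \<open>f\<^sub>c\<close>, the quartic \<open>f\<^sub>b\<close> is \<open>-\<xi>\<^sup>2\<close> times a quadratic whose larger root is
  \<open>\<xi>\<^sub>d\<close>.\<close>

lemma xi_c_in_Omega2: "xi_c U \<in> Omega2 U"
proof -
  define x where "x = xi_c U"
  have x: "x > 0" "f_c U x = 0" "x < xi_d U" "x \<ge> E - b"
    using xi_c_root f_c_root_ge[of x] xi_c_less_xi_d by (auto simp: x_def)
  have "f_b U x = x\<^sup>2 * (D\<^sup>2 + \<alpha> + \<beta> - 3 * x\<^sup>2 - 4 * (b - E) * x - (b - E)\<^sup>2 + E\<^sup>2 - 2 * E\<^sup>2
            + 2 * (E\<^sup>2 - D\<^sup>2 - \<alpha> - \<beta>)) + 2 * (2 * x + b) * f_c U x"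
    unfolding f_b_def f_a_def f_c_def split_tau split_mom by algebra
  also have "\<dots> = x\<^sup>2 * (((Phi U)\<^sup>2 - (3 * x + 2 * (b - E))\<^sup>2) / 3)"
    unfolding Phi_sq x(2) by (simp add: field_simps power2_eq_square)
  also have "(Phi U)\<^sup>2 - (3 * x + 2 * (b - E))\<^sup>2
      = (Phi U - (3 * x + 2 * (b - E))) * (Phi U + (3 * x + 2 * (b - E)))"
    by (simp add: power2_eq_square algebra_simps)
  finally have "f_b U x = x\<^sup>2 * ((Phi U - (3 * x + 2 * (b - E))) * (Phi U + (3 * x + 2 * (b - E))) / 3)" .
  moreover have "0 < Phi U - (3 * x + 2 * (b - E))" using x(3) by (simp add: xi_d_def)
  \<comment> \<open>Here \<open>3 * x + 2 * (b - E) = x + 2 * (x + b - E)\<close>, and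
    \<open>x + b - E\<close> is nonnegative at a root of \<open>f_c\<close>.\<close>
  moreover have "0 < Phi U + (3 * x + 2 * (b - E))" using abs_less_iff[THEN iffD1, OF Phi_gt] x(1,4) by argo
  ultimately have "f_b U x > 0"
    using x(1) by (simp only: mult_pos_pos zero_less_power divide_pos_pos zero_less_numeral)
  then have "x\<^sup>2 * S x - D\<^sup>2 > 0"
    using x(1) by (simp add: f_b_eq zero_less_mult_iff)
  then show ?thesis using x(1) by (simp add: Omega2_iff x_def)
qed

lemma xi_d_in_Omega2: "xi_d U \<in> Omega2 U"
  using xi_c_in_Omega2 xi_c_less_xi_d by (simp add: Omega2_def)

text \<open>On \<open>\<Omega>\<^sub>2\<close> the bound \<open>1 / W > D / \<xi>\<close> turns \<open>F\<close> into at most \<open>f\<^sub>c / \<xi>\<^sup>2\<close> minus the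
  pressure.\<close>

lemma F_xi_c_neg:
  assumes "pressure_at H U (xi_c U) > 0"
  shows "F H U (xi_c U) < 0"
proof -
  define x where "x = xi_c U"
  note x = Omega2_simps[OF xi_c_in_Omega2, folded x_def]
  have "x\<^sup>2 * S x \<ge> D\<^sup>2" using xi_c_in_Omega2 by (simp add: Omega2_iff x_def)
  then have "S x \<ge> D\<^sup>2 / x\<^sup>2" using x(1) by (simp add: divide_le_eq mult.commute)
  then have "b * S x \<ge> b * (D\<^sup>2 / x\<^sup>2)" by (intro mult_left_mono) simp_all
  moreover have "b / (lorentz U x)\<^sup>2 = b * S x"
    using x by (simp add: lorentz_eq power_divide)
  moreover have "x + b - E = (b * (D\<^sup>2 / x\<^sup>2) + (tau U)\<^sup>2 / x\<^sup>2) / 2"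
    using xi_c_root x(1) by (simp add: f_c_eq split_tau field_simps x_def[symmetric])
  ultimately show ?thesis
    using assms by (simp add: F_def x_def[symmetric]) argo
qed

end

subsection \<open>Differentiability of the pressure\<close>

context
  fixes H :: "real \<Rightarrow> real \<Rightarrow> real"
  assumes eos: "general_eos H"
begin

text \<open>Restricting the total derivative to the two coordinate lines identifies its coefficients
  with the partial derivatives that \<open>general_eos\<close> expresses through
  \<open>deriv\<close>.\<close>

lemma eos_has_derivative:
  assumes "\<rho> > 0" "p > 0"
  shows "((\<lambda>(r, q). H r q) has_derivative
           (\<lambda>(u, v). deriv (\<lambda>r. H r p) \<rho> * u + deriv (\<lambda>q. H \<rho> q) p * v)) (at (\<rho>, p))"
    and "((\<lambda>r. H r p) has_real_derivative deriv (\<lambda>r. H r p) \<rho>) (at \<rho>)"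
    and "((\<lambda>q. H \<rho> q) has_real_derivative deriv (\<lambda>q. H \<rho> q) p) (at p)"
proof -
  let ?Q = "{0<..} \<times> {0<..} :: (real \<times> real) set"
  have "open ?Q" by (intro open_Times) auto
  moreover have "(\<rho>, p) \<in> ?Q" using assms by simp
  moreover have "(\<lambda>(r, q). H r q) differentiable_on ?Q"
    using eos by (simp add: general_eos_def)
  ultimately have "(\<lambda>(r, q). H r q) differentiable (at (\<rho>, p))"
    by (metis at_within_open differentiable_on_def)
  then obtain L where L: "((\<lambda>(r, q). H r q) has_derivative L) (at (\<rho>, p))"
    by (auto simp: differentiable_def)
  then interpret L: bounded_linear L by (rule has_derivative_bounded_linear)
  have "((\<lambda>r. (r, p)) has_derivative (\<lambda>u. (u, 0))) (at \<rho>)"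
    and "((\<lambda>q. (\<rho>, q)) has_derivative (\<lambda>v. (0, v))) (at p)"
    by (auto intro!: derivative_eq_intros)
  from this[THEN has_derivative_compose, of "\<lambda>(r, q). H r q" L]
  have "((\<lambda>r. H r p) has_derivative (\<lambda>u. L (u, 0))) (at \<rho>)"
    and "((\<lambda>q. H \<rho> q) has_derivative (\<lambda>v. L (0, v))) (at p)"
    using L by simp_all
  moreover have "(\<lambda>u. L (u, 0)) = (*) (L (1, 0))" "(\<lambda>v. L (0, v)) = (*) (L (0, 1))"
  proof (rule_tac [!] ext)
    fix u show "L (u, 0) = L (1, 0) * u" "L (0, u) = L (0, 1) * u"
      using L.scaleR[of u "(1, 0)"] L.scaleR[of u "(0, 1)"] by simp_all
  qed
  ultimately have d: "((\<lambda>r. H r p) has_real_derivative L (1, 0)) (at \<rho>)"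
    "((\<lambda>q. H \<rho> q) has_real_derivative L (0, 1)) (at p)"
    unfolding has_field_derivative_def by (simp_all only:)
  then have eq: "deriv (\<lambda>r. H r p) \<rho> = L (1, 0)" "deriv (\<lambda>q. H \<rho> q) p = L (0, 1)"
    by (simp_all add: DERIV_imp_deriv)
  with d show "((\<lambda>r. H r p) has_real_derivative deriv (\<lambda>r. H r p) \<rho>) (at \<rho>)"
    and "((\<lambda>q. H \<rho> q) has_real_derivative deriv (\<lambda>q. H \<rho> q) p) (at p)"
    by simp_all
  have "L = (\<lambda>(u, v). deriv (\<lambda>r. H r p) \<rho> * u + deriv (\<lambda>q. H \<rho> q) p * v)"
  proof (intro ext, clarify)
    fix u v
    show "L (u, v) = deriv (\<lambda>r. H r p) \<rho> * u + deriv (\<lambda>q. H \<rho> q) p * v"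
      using L.add[of "(u, 0)" "(0, v)"] L.scaleR[of u "(1, 0)"] L.scaleR[of v "(0, 1)"]
      by (simp add: eq mult.commute)
  qed
  with L show "((\<lambda>(r, q). H r q) has_derivative
           (\<lambda>(u, v). deriv (\<lambda>r. H r p) \<rho> * u + deriv (\<lambda>q. H \<rho> q) p * v)) (at (\<rho>, p))"
    by simp
qed

text \<open>With \<open>t = p / \<rho>\<close>, the root \<open>sqrt (1 + t\<^sup>2)\<close> exceeds
  \<open>t\<close> and is at least \<open>1\<close>. The first bound later limits the pressure to
  half of \<open>\<rho> * h\<close>.\<close>

lemma eos_gt:
  assumes "\<rho> > 0" "p > 0"
  shows "H \<rho> p > 2 * p / \<rho>" "H \<rho> p > 1"
proof -
  have ge: "sqrt (1 + p\<^sup>2 / \<rho>\<^sup>2) + p / \<rho> \<le> H \<rho> p" using eos assms by (simp add: general_eos_def)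
  have "sqrt ((p / \<rho>)\<^sup>2) < sqrt (1 + p\<^sup>2 / \<rho>\<^sup>2)"
    by (intro real_sqrt_less_mono) (simp add: power_divide)
  then show "H \<rho> p > 2 * p / \<rho>" using ge assms by simp
  have "1 \<le> sqrt (1 + p\<^sup>2 / \<rho>\<^sup>2)" by simp
  moreover have "p / \<rho> > 0" using assms by simp
  ultimately show "H \<rho> p > 1" using ge by linarith
qed

text \<open>The last claim follows from the signs in the other two, as \<open>H \<rho> p\<close> is
  positive. It makes \<open>H\<close> strictly increasing in the pressure.\<close>

lemma eos_partials:
  assumes "\<rho> > 0" "p > 0"
  shows "deriv (\<lambda>r. H r p) \<rho> < 0"
    and "H \<rho> p * (1 / \<rho> - deriv (\<lambda>q. H \<rho> q) p) < deriv (\<lambda>r. H r p) \<rho>"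
    and "deriv (\<lambda>q. H \<rho> q) p > 1 / \<rho>"
proof -
  show *: "deriv (\<lambda>r. H r p) \<rho> < 0"
    "H \<rho> p * (1 / \<rho> - deriv (\<lambda>q. H \<rho> q) p) < deriv (\<lambda>r. H r p) \<rho>"
    using eos assms by (auto simp: general_eos_def)
  then have "H \<rho> p * (1 / \<rho> - deriv (\<lambda>q. H \<rho> q) p) < 0" by linarith
  then show "deriv (\<lambda>q. H \<rho> q) p > 1 / \<rho>"
    using eos_gt(2)[OF assms] by (simp add: mult_less_0_iff)
qed

lemma eos_strict_mono:
  assumes "\<rho> > 0" "0 < p" "p < q"
  shows "H \<rho> p < H \<rho> q"
proof (rule DERIV_pos_imp_increasing[OF assms(3)])
  fix y assume "p \<le> y" "y \<le> q"
  then have "y > 0" using assms by linarith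
  then show "\<exists>d. ((\<lambda>q. H \<rho> q) has_real_derivative d) (at y) \<and> d > 0"
    using eos_has_derivative(3)[OF assms(1)] eos_partials(3)[OF assms(1)] assms(1)
    by (meson less_trans zero_less_divide_1_iff)
qed

lemma pressure_works:
  assumes "\<rho> > 0" "h > 1"
  shows "pressure H \<rho> h > 0" "H \<rho> (pressure H \<rho> h) = h"
proof -
  have "\<exists>!p. p > 0 \<and> H \<rho> p = h" using eos assms by (simp add: general_eos_def)
  from theI'[OF this] show "pressure H \<rho> h > 0" "H \<rho> (pressure H \<rho> h) = h"
    using assms by (simp_all add: pressure_def)
qed

lemma pressure_upper:
  assumes "\<rho> > 0" "h > 1"
  shows "pressure H \<rho> h < \<rho> * h / 2"
  using eos_gt(1)[OF assms(1) pressure_works(1)[OF assms]] pressure_works[OF assms] assms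
  by (simp add: field_simps)

text \<open>The strict inequalities \<open>H \<rho> (p - d) < h < H \<rho> (p + d)\<close> persist
  for nearby density and enthalpy, because \<open>H\<close> is continuous in the density at each
  fixed pressure. Monotonicity in the pressure then traps the solution between \<open>p - d\<close>
  and \<open>p + d\<close>.\<close>

lemma isCont_pressure:
  assumes "\<rho> > 0" "h > 1"
  shows "isCont (\<lambda>(r, g). pressure H r g) (\<rho>, h)"
  unfolding isCont_def
proof (rule tendstoI)
  fix e :: real assume "e > 0"
  define p where "p = pressure H \<rho> h"
  define d where "d = min e p / 2"
  have p: "p > 0" "H \<rho> p = h" using pressure_works[OF assms] by (simp_all add: p_def)
  have d: "d > 0" "d < e" "p - d > 0" using p \<open>e > 0\<close> by (auto simp: d_def min_def)
  have cont: "isCont (\<lambda>y. H (fst y) q - snd y) (\<rho>, h)" if "q > 0" for q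
  proof -
    have "isCont (\<lambda>r. H r q) (fst (\<rho>, h))"
      using DERIV_isCont[OF eos_has_derivative(2)[OF assms(1) that]] by simp
    then show ?thesis
      by (intro continuous_diff isCont_o2[OF isCont_fst] continuous_snd continuous_ident) auto
  qed
  have "\<forall>\<^sub>F y in at (\<rho>, h). H (fst y) (p - d) - snd y < 0"
    using cont[of "p - d"] eos_strict_mono[of \<rho> "p - d" p] p d assms
    by (intro order_tendstoD(2)[of _ "H \<rho> (p - d) - h"]) (auto simp: isCont_def)
  moreover have "\<forall>\<^sub>F y in at (\<rho>, h). H (fst y) (p + d) - snd y > 0"
    using cont[of "p + d"] eos_strict_mono[of \<rho> p "p + d"] p d assms
    by (intro order_tendstoD(1)[of _ "H \<rho> (p + d) - h"]) (auto simp: isCont_def)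
  moreover have "\<forall>\<^sub>F y in at (\<rho>, h). y \<in> {0<..} \<times> {1<..}"
    using assms by (intro eventually_at_in_open') (auto intro: open_Times)
  ultimately show "\<forall>\<^sub>F y in at (\<rho>, h). dist (case y of (r, g) \<Rightarrow> pressure H r g) (case (\<rho>, h) of (r, g) \<Rightarrow> pressure H r g) < e"
  proof eventually_elim
    case (elim y)
    obtain r g where y: "y = (r, g)" by fastforce
    define q where "q = pressure H r g"
    have rg: "r > 0" "g > 1" using elim y by auto
    have q: "q > 0" "H r q = g" using pressure_works[OF rg] by (simp_all add: q_def)
    have "p - d < q"
      using elim(1) eos_strict_mono[OF rg(1) q(1), of "p - d"] q d
      by (cases "p - d" q rule: linorder_cases) (auto simp: y)
    moreover have "q < p + d"
      using elim(2) eos_strict_mono[OF rg(1), of "p + d" q] q d p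
      by (cases "p + d" q rule: linorder_cases) (auto simp: y)
    ultimately show ?case using d by (simp add: y dist_real_def p_def q_def)
  qed
qed

text \<open>The map \<open>?f\<close> is inverted by \<open>?g\<close>. As \<open>H\<close> is only
  differentiable, the derivative of the inverse is obtained pointwise from the invertible derivative
  of \<open>?f\<close> and the continuity of \<open>?g\<close>.\<close>

lemma pressure_has_derivative:
  assumes "\<rho> > 0" "h > 1"
  defines "p \<equiv> pressure H \<rho> h"
  shows "((\<lambda>(r, g). pressure H r g) has_derivative
     (\<lambda>(u, v). (v - deriv (\<lambda>r. H r p) \<rho> * u) / deriv (\<lambda>q. H \<rho> q) p)) (at (\<rho>, h))"
proof -
  let ?f = "\<lambda>y. (fst y, H (fst y) (snd y))"
  let ?g = "\<lambda>y. (fst y, case y of (r, g) \<Rightarrow> pressure H r g)"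
  let ?A = "deriv (\<lambda>r. H r p) \<rho>" and ?B = "deriv (\<lambda>q. H \<rho> q) p"
  have p: "p > 0" "H \<rho> p = h" using pressure_works[OF assms(1,2)] by (simp_all add: p_def)
  have "?B > 0" using eos_partials(3)[OF assms(1) p(1)] assms(1)
    by (meson less_trans zero_less_divide_1_iff)
  have "(?g has_derivative (\<lambda>y. (fst y, (snd y - ?A * fst y) / ?B))) (at (\<rho>, h))"
  proof (rule has_derivative_inverse_basic[where f = ?f and f' = "\<lambda>y. (fst y, ?A * fst y + ?B * snd y)"
        and T = "{0<..} \<times> {1<..}"])
    show "(?f has_derivative (\<lambda>y. (fst y, ?A * fst y + ?B * snd y))) (at (?g (\<rho>, h)))"
      using has_derivative_Pair[OF has_derivative_fst[OF has_derivative_ident]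
          eos_has_derivative(1)[OF assms(1) p(1), unfolded case_prod_beta']]
      by (simp add: p_def)
    show "bounded_linear (\<lambda>y. (fst y, (snd y - ?A * fst y) / ?B))"
      by (intro bounded_linear_Pair bounded_linear_fst bounded_linear_compose[OF bounded_linear_divide]
          bounded_linear_sub bounded_linear_snd bounded_linear_compose[OF bounded_linear_mult_right])
    show "(\<lambda>y. (fst y, (snd y - ?A * fst y) / ?B)) \<circ> (\<lambda>y. (fst y, ?A * fst y + ?B * snd y)) = id"
      using \<open>?B > 0\<close> by (auto simp: fun_eq_iff)
    show "isCont ?g (\<rho>, h)"
      by (intro continuous_Pair continuous_fst continuous_ident isCont_pressure assms)
    show "open ({0<..} \<times> {1<..} :: (real \<times> real) set)" by (intro open_Times) auto
  qed (use assms pressure_works in auto)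
  from has_derivative_snd[OF this] show ?thesis by (simp add: case_prod_beta')
qed

end

subsection \<open>The second derivative for the gamma law\<close>

text \<open>The expression is, up to a positive factor, the derivative of \<open>Y\<close> below; expanded in
  \<open>A\<close>, \<open>C\<close>, \<open>S\<close>, \<open>k - 2\<close>, \<open>t\<close> and \<open>1 - t\<close> it can be written with nonnegative coefficients
  only.\<close>

lemma gamma_polynomial_nonneg:
  fixes A C t S k :: real
  assumes nn: "A \<ge> 0" "C \<ge> 0" "S \<ge> 0" and t: "0 \<le> t" "t \<le> 1" and k: "k \<ge> 2"
  defines "R \<equiv> 2 * A + C * t * (2 * t + k * (1 - t))"
    and "T \<equiv> 3 * S * (A + C * t\<^sup>2) + (A + C * t)\<^sup>2"
    and "R' \<equiv> - 2 * A + C * t * (2 * t * (3 - 4 * t) + 2 * k * (1 - t) * (1 - 2 * t))"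
    and "T' \<equiv> 6 * (A + C * t) * (A + C * t\<^sup>2) + 3 * S * (- 2 * A + C * t\<^sup>2 * (2 - 4 * t))
                + 2 * (A + C * t) * (- 2 * A + C * t * (1 - 3 * t))"
  shows "0 \<le> R' * T * S + 3 * (A + C * t) * R * T - S * R * T'"
proof -
  define w where "w = 1 - t"
  define j where "j = k - 2"
  have nn': "w \<ge> 0" "j \<ge> 0" using t k by (simp_all add: w_def j_def)
  have "R' * T * S + 3 * (A + C * t) * R * T - S * R * T' =
      6 * C^2 * S^2 * t^4 + C^3 * S * (12 * t^4 + 5 * j * t^4 * w)
    + C^4 * (6 * t^4 + 3 * j * t^4 * w)
    + A * C * S^2 * (12 * t * (2 * w^2 + t * w + t^2) + 12 * j * t * w^2)
    + A * C^2 * S * (12 * t^2 + 24 * t^3 + j * t^2 * w * (9 + t))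
    + A * C^3 * (24 * t^3 + 9 * j * t^3 * w) + 6 * A^2 * S^2
    + A^2 * C * S * (24 * t + 12 * t^2 + j * t * w * (5 + 4 * w))
    + A^2 * C^2 * (36 * t^2 + 9 * j * t^2 * w) + 12 * A^3 * S
    + A^3 * C * (24 * t + 3 * j * t * w) + 6 * A^4"
    unfolding R_def T_def R'_def T'_def w_def j_def by algebra
  also have "\<dots> \<ge> 0"
    by (intro add_nonneg_nonneg mult_nonneg_nonneg zero_le_power nn nn' t) simp_all
  finally show ?thesis .
qed

section \<open>Velocity components, their derivatives, and monotonicity of \<open>Y\<close>\<close>

context orthogonal_split
begin

text \<open>\<open>A\<close> and \<open>C\<close> are the squared velocity components along and
  across the magnetic field; \<open>\<theta>\<close> comes from the logarithmic derivative of
  \<open>C\<close>. Applying \<open>x\<close> times the derivative to any of the three gives a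
  polynomial in them.\<close>

definition A :: "real \<Rightarrow> real" where "A x = \<alpha> / x\<^sup>2"
definition C :: "real \<Rightarrow> real" where "C x = \<beta> / (x + b)\<^sup>2"
definition \<theta> :: "real \<Rightarrow> real" where "\<theta> x = x / (x + b)"
text \<open>\<open>R\<close> and \<open>T\<close> are the coefficients in the second derivative of
  \<open>F\<close> for the gamma law, see \<open>has_deriv_G\<close>, where
  \<open>k = 3 / a - 4\<close>.\<close>

definition R :: "real \<Rightarrow> real \<Rightarrow> real" where
  "R k x = 2 * A x + C x * \<theta> x * (2 * \<theta> x + k * (1 - \<theta> x))"
definition T :: "real \<Rightarrow> real" where
  "T x = 3 * S x * (A x + C x * (\<theta> x)\<^sup>2) + (A x + C x * \<theta> x)\<^sup>2"

lemma S_eq: "S x = 1 - A x - C x"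
  by (simp add: S_def A_def C_def)

lemma A_C_nonneg: "A x \<ge> 0" "C x \<ge> 0"
  using split_nonneg by (simp_all add: A_def C_def)

lemma theta_bounds: "x > 0 \<Longrightarrow> 0 < \<theta> x" "x > 0 \<Longrightarrow> \<theta> x \<le> 1"
  using xb_pos[of x] by (simp_all add: \<theta>_def)

lemma has_deriv_A: "x > 0 \<Longrightarrow> (A has_real_derivative - 2 * A x / x) (at x)"
  unfolding A_def[abs_def]
  by (auto intro!: derivative_eq_intros simp: field_simps power2_eq_square)

lemma has_deriv_C: "x > 0 \<Longrightarrow> (C has_real_derivative - 2 * C x * \<theta> x / x) (at x)"
  unfolding C_def[abs_def] \<theta>_def using xb_neq_0[of x]
  by (auto intro!: derivative_eq_intros simp: divide_simps) algebra

lemma has_deriv_theta: "x > 0 \<Longrightarrow> (\<theta> has_real_derivative \<theta> x * (1 - \<theta> x) / x) (at x)"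
  unfolding \<theta>_def[abs_def] using xb_neq_0[of x]
  by (auto intro!: derivative_eq_intros simp: divide_simps) 

lemma has_deriv_S: "x > 0 \<Longrightarrow> (S has_real_derivative 2 * (A x + C x * \<theta> x) / x) (at x)"
  unfolding S_eq[abs_def]
  by (auto intro!: derivative_eq_intros has_deriv_A has_deriv_C simp: divide_simps algebra_simps)

lemma has_deriv_sqrt_S:
  assumes "x > 0" "S x > 0"
  shows "((\<lambda>x. sqrt (S x)) has_real_derivative (A x + C x * \<theta> x) / (x * sqrt (S x))) (at x)"
  using assms
  by (auto intro!: derivative_eq_intros has_deriv_S simp: divide_simps)

lemma has_deriv_R:
  assumes "x > 0"
  shows "(R k has_real_derivative
    (- 4 * A x + (2 - k) * C x * (\<theta> x)\<^sup>2 * (2 - 4 * \<theta> x) + k * C x * \<theta> x * (1 - 3 * \<theta> x)) / x) (at x)"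
  unfolding R_def[abs_def]
  by (rule derivative_eq_intros has_deriv_A has_deriv_C has_deriv_theta refl assms)+
     (use assms in \<open>simp add: divide_simps\<close>, algebra)

lemma has_deriv_T:
  assumes "x > 0"
  shows "(T has_real_derivative
    (6 * (A x + C x * \<theta> x) * (A x + C x * (\<theta> x)\<^sup>2) + 3 * S x * (- 2 * A x + C x * (\<theta> x)\<^sup>2 * (2 - 4 * \<theta> x))
      + 2 * (A x + C x * \<theta> x) * (- 2 * A x + C x * \<theta> x * (1 - 3 * \<theta> x))) / x) (at x)"
  unfolding T_def[abs_def]
  by (rule derivative_eq_intros has_deriv_A has_deriv_C has_deriv_theta has_deriv_S refl assms)+
     (use assms in \<open>simp add: divide_simps\<close>, algebra)

text \<open>Some velocity component is nonzero, which justifies dividing by \<open>T\<close> in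
  \<open>Y\<close>; for \<open>\<alpha> = \<beta> = 0\<close> the function \<open>T\<close>
  vanishes.\<close>

lemma T_pos:
  assumes "x > 0" "S x > 0" "\<alpha> + \<beta> > 0"
  shows "T x > 0"
proof -
  have "A x + C x * (\<theta> x)\<^sup>2 > 0"
  proof (cases "\<alpha> > 0")
    case True
    then show ?thesis using assms(1) A_C_nonneg
      by (intro add_pos_nonneg) (auto simp: A_def)
  next
    case False
    then have "\<beta> > 0" using split_nonneg assms by simp
    then show ?thesis using assms(1) A_C_nonneg theta_bounds[of x] xb_pos[of x]
      by (intro add_nonneg_pos) (auto simp: C_def)
  qed
  then show ?thesis
    unfolding T_def using assms(2) by (intro add_pos_nonneg) simp_all
qed

text \<open>The value of \<open>D\<close> at which the bracket in \<open>has_deriv_G\<close> changes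
  sign.\<close>

definition Y :: "real \<Rightarrow> real \<Rightarrow> real" where
  "Y k x = x * (S x * sqrt (S x)) * R k x / T x"

lemma Y_mono:
  assumes k: "k \<ge> 2" and x: "0 < x" "S x > 0" "x \<le> y" and "\<alpha> + \<beta> > 0"
  shows "Y k x \<le> Y k y"
proof (rule DERIV_nonneg_imp_nondecreasing[OF x(3)])
  fix z assume "x \<le> z" "z \<le> y"
  then have z: "z > 0" "S z > 0" using x S_mono[of x z] by auto
  define s where "s = sqrt (S z)"
  have s: "s > 0" "S z = s\<^sup>2" using z by (simp_all add: s_def)
  define R' where "R' = - 4 * A z + (2 - k) * C z * (\<theta> z)\<^sup>2 * (2 - 4 * \<theta> z) + k * C z * \<theta> z * (1 - 3 * \<theta> z)"
  define T' where "T' = 6 * (A z + C z * \<theta> z) * (A z + C z * (\<theta> z)\<^sup>2) + 3 * S z * (- 2 * A z + C z * (\<theta> z)\<^sup>2 * (2 - 4 * \<theta> z))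
      + 2 * (A z + C z * \<theta> z) * (- 2 * A z + C z * \<theta> z * (1 - 3 * \<theta> z))"
  define u where "u = A z + C z * \<theta> z"
  have T: "T z > 0" using z assms by (intro T_pos) auto
  have dS: "(S has_real_derivative 2 * u / z) (at z)"
    and ds: "((\<lambda>x. sqrt (S x)) has_real_derivative u / (z * s)) (at z)"
    and dR: "(R k has_real_derivative R' / z) (at z)" and dT: "(T has_real_derivative T' / z) (at z)"
    using has_deriv_S[OF z(1)] has_deriv_sqrt_S[OF z] has_deriv_R[OF z(1)] has_deriv_T[OF z(1)]
    by (simp_all only: u_def R'_def T'_def s_def)
  \<comment> \<open>The derivative of \<open>Y\<close> without its positive factor
    \<open>s / (T z)\<^sup>2\<close>; here \<open>R'\<close> and \<open>T'\<close> are
    \<open>z\<close> times the derivatives of \<open>R k\<close> and \<open>T\<close>.\<close>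
  define e where "e = (R k z + R') * T z * S z + 3 * u * R k z * T z - S z * R k z * T'"
  have "(Y k has_real_derivative s / (T z)\<^sup>2 * e) (at z)"
    unfolding Y_def[abs_def]
  proof (rule DERIV_cong[OF DERIV_divide[OF
        DERIV_mult[OF DERIV_mult[OF DERIV_ident DERIV_mult[OF dS ds]] dR] dT]])
    show "T z \<noteq> 0" using T by simp
    show "(((1 * (S z * sqrt (S z)) + (2 * u / z * sqrt (S z) + u / (z * s) * S z) * z) * R k z
        + R' / z * (z * (S z * sqrt (S z)))) * T z - z * (S z * sqrt (S z)) * R k z * (T' / z)) / (T z * T z)
        = s / (T z)\<^sup>2 * e"
      unfolding s_def[symmetric] e_def s(2) using T s(1) z(1)
      by (simp add: divide_simps) algebra
  qed
  moreover have "e \<ge> 0"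
  proof -
    \<comment> \<open>The summand \<open>R k z\<close> stems from the factor \<open>x\<close> in
      \<open>Y\<close>; the sum is what \<open>gamma_polynomial_nonneg\<close> calls
      \<open>R'\<close>.\<close>
    have "R k z + R' = - 2 * A z + C z * \<theta> z * (2 * \<theta> z * (3 - 4 * \<theta> z) + 2 * k * (1 - \<theta> z) * (1 - 2 * \<theta> z))"
      by (simp add: R_def R'_def) algebra
    then have "e = (- 2 * A z + C z * \<theta> z * (2 * \<theta> z * (3 - 4 * \<theta> z) + 2 * k * (1 - \<theta> z) * (1 - 2 * \<theta> z)))
        * T z * S z + 3 * u * R k z * T z - S z * R k z * T'"
      by (simp only: e_def)
    then show ?thesis
      unfolding T'_def u_def R_def T_def
      using gamma_polynomial_nonneg[of "A z" "C z" "S z" "\<theta> z" k] A_C_nonneg[of z] z theta_bounds[of z] k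
      by (simp only: less_imp_le)
  qed
  ultimately show "\<exists>d. (Y k has_real_derivative d) (at z) \<and> d \<ge> 0"
    using s(1) by (intro exI[of _ "s / (T z)\<^sup>2 * e"]) simp
qed

end

section \<open>The gamma law as an equation of state\<close>

text \<open>The bound \<open>\<gamma> \<le> 2\<close> enters as \<open>g \<ge> 2\<close>. With
  \<open>t = p / r\<close> the two main inequalities become
  \<open>sqrt (1 + t\<^sup>2) + t \<le> 1 + 2 * t \<le> 1 + g * t\<close> and
  \<open>g * t < (g - 1) * (1 + g * t)\<close>.\<close>

lemma gamma_law_general_eos:
  assumes \<gamma>: "1 < \<gamma>" "\<gamma> \<le> 2" and H: "gamma_law \<gamma> H"
  shows "general_eos H"
proof -
  define g where "g = \<gamma> / (\<gamma> - 1)"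
  have g: "g \<ge> 2" using \<gamma> by (simp add: g_def field_simps)
  have eq: "H r p = 1 + g * p / r" if "r > 0" "p > 0" for r p
    using H that by (simp add: gamma_law_def g_def)
  have derivs: "deriv (\<lambda>r. H r p) r = - g * p / r\<^sup>2" "deriv (\<lambda>q. H r q) p = g / r"
    if "r > 0" "p > 0" for r p
  proof -
    have "((\<lambda>r. 1 + g * p / r) has_real_derivative - g * p / r\<^sup>2) (at r)"
      using that by (auto intro!: derivative_eq_intros simp: power2_eq_square)
    then have "((\<lambda>r. H r p) has_real_derivative - g * p / r\<^sup>2) (at r)"
      by (rule has_field_derivative_transform_within_open[of _ _ _ "{0<..}"]) (use that eq in auto)
    then show "deriv (\<lambda>r. H r p) r = - g * p / r\<^sup>2" by (rule DERIV_imp_deriv)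
    have "((\<lambda>q. 1 + g * q / r) has_real_derivative g / r) (at p)"
      using that by (auto intro!: derivative_eq_intros)
    then have "((\<lambda>q. H r q) has_real_derivative g / r) (at p)"
      by (rule has_field_derivative_transform_within_open[of _ _ _ "{0<..}"]) (use that eq in auto)
    then show "deriv (\<lambda>q. H r q) p = g / r" by (rule DERIV_imp_deriv)
  qed
  have eq_pair: "1 + g * snd y / fst y = (case y of (r, p) \<Rightarrow> H r p)" if "y \<in> {0<..} \<times> {0<..}" for y
    using that eq by auto
  have "(\<lambda>y. 1 + g * snd y / fst y) differentiable_on {0<..} \<times> {0<..}"
    unfolding differentiable_on_def
    by (auto intro!: derivative_intros
        bounded_linear_imp_differentiable[OF bounded_linear_fst]
        bounded_linear_imp_differentiable[OF bounded_linear_snd])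
  then have diff: "(\<lambda>(r, p). H r p) differentiable_on {0<..} \<times> {0<..}"
    unfolding differentiable_on_def
    by (intro ballI differentiable_transform_within[OF _ zero_less_one _ eq_pair]) auto
  have lower: "sqrt (1 + p\<^sup>2 / r\<^sup>2) + p / r \<le> H r p" if "r > 0" "p > 0" for r p
  proof -
    define t where "t = p / r"
    have t: "t > 0" using that by (simp add: t_def)
    have "1 + t\<^sup>2 \<le> (1 + t)\<^sup>2" using t by (simp add: power2_eq_square algebra_simps)
    then have "sqrt (1 + t\<^sup>2) \<le> 1 + t" using t by (intro real_le_lsqrt) auto
    moreover have "2 * t \<le> g * t" using g t by (intro mult_right_mono) auto
    ultimately have "sqrt (1 + t\<^sup>2) + t \<le> 1 + g * t" by linarith
    then show ?thesis by (simp add: t_def power_divide eq[OF that])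
  qed
  have partials: "H r p * (1 / r - deriv (\<lambda>q. H r q) p) < deriv (\<lambda>r. H r p) r"
    "deriv (\<lambda>r. H r p) r < 0" if "r > 0" "p > 0" for r p
  proof -
    show "deriv (\<lambda>r. H r p) r < 0" using that g by (simp add: derivs)
    have "H r p * (1 / r - g / r) = - ((g - 1) * (1 + g * p / r) / r)"
      by (simp add: eq[OF that] diff_divide_distrib[symmetric]) (simp add: algebra_simps diff_divide_distrib)
    also have "\<dots> < - g * p / r\<^sup>2"
    proof -
      have "g * p / r < (g - 1) * (1 + g * p / r)"
        using g that mult_right_mono[of 1 "g - 1" "1 + g * p / r"] by simp
      then have "g * p / r / r < (g - 1) * (1 + g * p / r) / r"
        using that by (simp only: divide_strict_right_mono)
      then show ?thesis by (simp add: power2_eq_square)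
    qed
    finally show "H r p * (1 / r - deriv (\<lambda>q. H r q) p) < deriv (\<lambda>r. H r p) r"
      by (simp add: derivs that)
  qed
  have limit: "((\<lambda>p. H r p) \<longlongrightarrow> 1) (at_right 0)" if "r > 0" for r
  proof -
    have "((\<lambda>p. 1 + g * p / r) \<longlongrightarrow> 1 + g * 0 / r) (at_right 0)"
      using that by (intro tendsto_intros) auto
    then have "((\<lambda>p. 1 + g * p / r) \<longlongrightarrow> 1) (at_right 0)" by simp
    moreover have "\<forall>\<^sub>F p in at_right 0. 1 + g * p / r = H r p"
      using eventually_at_right_less by eventually_elim (simp add: eq that)
    ultimately show ?thesis by (rule Lim_transform_eventually)
  qed
  have unique: "\<exists>!p. p > 0 \<and> H r p = h" if "r > 0" "h > 1" for r h
  proof (rule ex1I[of _ "(h - 1) * r / g"])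
    show "(h - 1) * r / g > 0 \<and> H r ((h - 1) * r / g) = h" using that g by (simp add: eq)
    fix p assume "p > 0 \<and> H r p = h"
    then show "p = (h - 1) * r / g" using that g by (auto simp: eq field_simps)
  qed
  show ?thesis
    unfolding general_eos_def by (intro conjI allI impI diff lower partials limit unique)
qed

lemma pressure_gamma_law:
  assumes \<gamma>: "1 < \<gamma>" "\<gamma> \<le> 2" and H: "gamma_law \<gamma> H" and "r > 0" "h > 1"
  shows "pressure H r h = (\<gamma> - 1) / \<gamma> * r * (h - 1)"
proof -
  define a where "a = (\<gamma> - 1) / \<gamma>"
  have a: "a > 0" using \<gamma> by (simp add: a_def)
  have eq: "H r p = 1 + p / (a * r)" if "p > 0" for p
    using H that \<open>r > 0\<close> by (simp add: gamma_law_def a_def mult.commute)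
  have "(THE p. p > 0 \<and> H r p = h) = a * r * (h - 1)"
  proof (rule the_equality)
    show "0 < a * r * (h - 1) \<and> H r (a * r * (h - 1)) = h"
      using a assms(4,5) by (simp add: eq)
    fix p assume "0 < p \<and> H r p = h"
    then have "p / (a * r) = h - 1" "p > 0" by (auto simp: eq)
    then show "p = a * r * (h - 1)" using a assms(4) by (simp add: field_simps)
  qed
  then show ?thesis using assms(5) by (simp add: pressure_def a_def)
qed

section \<open>First and second derivative of \<open>F\<close> for the gamma law\<close>

context orthogonal_split
begin

text \<open>For \<open>a = (\<gamma> - 1) / \<gamma>\<close> this is the derivative of
  \<open>F\<close> on \<open>Omega2 U\<close>, by \<open>F_gamma_has_deriv\<close>.\<close>

definition G :: "real \<Rightarrow> real \<Rightarrow> real" where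
  "G a x = 1 - a * (S x + 2 * (A x + C x * \<theta> x))
         + a * D * (A x + C x * \<theta> x) / (x * sqrt (S x)) - C x * (1 - \<theta> x)"

text \<open>The terms free of \<open>D\<close> contain
  \<open>C x * \<theta> x * (1 - \<theta> x)\<close> with coefficient \<open>3 - 4 * a\<close>: the
  \<open>3\<close> comes from the magnetic term, the \<open>- 4 * a\<close> from the pressure.
  Division by \<open>a\<close> yields the parameter of \<open>R\<close>.\<close>

lemma has_deriv_G:
  assumes x: "x > 0" "S x > 0" and a: "a > 0"
  shows "(G a has_real_derivative
     a / x\<^sup>2 * (x * R (3 / a - 4) x - D * T x / (S x * sqrt (S x)))) (at x)"
proof -
  define s where "s = sqrt (S x)"
  have s: "s > 0" "S x = s\<^sup>2" using x by (simp_all add: s_def)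
  define u where "u = A x + C x * \<theta> x"
  define u' where "u' = - 2 * A x + C x * \<theta> x * (1 - 3 * \<theta> x)"
  have dS: "(S has_real_derivative 2 * u / x) (at x)"
    and ds: "((\<lambda>x. sqrt (S x)) has_real_derivative u / (x * s)) (at x)"
    using has_deriv_S[OF x(1)] has_deriv_sqrt_S[OF x] by (simp_all only: u_def s_def)
  have du: "((\<lambda>x. A x + C x * \<theta> x) has_real_derivative u' / x) (at x)"
    unfolding u'_def
    by (rule derivative_eq_intros has_deriv_A has_deriv_C has_deriv_theta refl x)+
       (use x in \<open>simp add: divide_simps\<close>, algebra)
  have d4: "((\<lambda>x. C x * (1 - \<theta> x)) has_real_derivative - 3 * C x * (1 - \<theta> x) * \<theta> x / x) (at x)"
    by (rule derivative_eq_intros has_deriv_C has_deriv_theta refl x)+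
       (use x in \<open>simp add: field_simps\<close>)
  have d2: "((\<lambda>x. a * (S x + 2 * (A x + C x * \<theta> x))) has_real_derivative a * (2 * u / x + 2 * (u' / x))) (at x)"
    by (intro DERIV_cmult DERIV_add dS du)
  have d3: "((\<lambda>x. a * D * (A x + C x * \<theta> x) / (x * sqrt (S x))) has_real_derivative
     ((a * D * (u' / x)) * (x * s) - (a * D * u) * (1 * s + u / (x * s) * x)) / ((x * s) * (x * s))) (at x)"
    using DERIV_divide[OF DERIV_cmult[OF du] DERIV_mult[OF DERIV_ident ds], of "a * D"] x
    by (simp add: s_def u_def)
  show ?thesis
    unfolding G_def[abs_def]
  proof (rule DERIV_cong[OF DERIV_diff[OF DERIV_add[OF DERIV_diff[OF DERIV_const d2] d3] d4]])
    have Tx: "T x = 3 * s\<^sup>2 * (A x + C x * (\<theta> x)\<^sup>2) + u\<^sup>2" by (simp add: T_def s u_def)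
    have "a * R (3 / a - 4) x = 2 * a * A x + 2 * a * C x * (\<theta> x)\<^sup>2
         + (3 - 4 * a) * C x * \<theta> x * (1 - \<theta> x)"
      using a by (simp add: R_def field_simps power2_eq_square)
    then have aR: "a / x\<^sup>2 * (x * R (3 / a - 4) x) = (2 * a * A x + 2 * a * C x * (\<theta> x)\<^sup>2
         + (3 - 4 * a) * C x * \<theta> x * (1 - \<theta> x)) / x"
      using x by (simp add: power2_eq_square)
    show "0 - a * (2 * u / x + 2 * (u' / x)) +
     ((a * D * (u' / x)) * (x * s) - (a * D * u) * (1 * s + u / (x * s) * x)) / ((x * s) * (x * s))
     - (- 3 * C x * (1 - \<theta> x) * \<theta> x / x)
     = a / x\<^sup>2 * (x * R (3 / a - 4) x - D * T x / (S x * sqrt (S x)))"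
      unfolding right_diff_distrib[of "a / x\<^sup>2"] s_def[symmetric] Tx aR s(2)
      using x s(1) unfolding u'_def u_def
      by (simp add: divide_simps) algebra
  qed
qed

lemma has_deriv_magnetic_term:
  assumes x: "x > 0"
  shows "((\<lambda>y. b * \<beta> / (2 * (y + b)\<^sup>2)) has_real_derivative - C x * (1 - \<theta> x)) (at x)"
proof -
  have "((\<lambda>y. b / 2 * C y) has_real_derivative b / 2 * (- 2 * C x * \<theta> x / x)) (at x)"
    by (intro DERIV_cmult has_deriv_C x)
  moreover have "b / 2 * (- 2 * C x * \<theta> x / x) = - C x * (1 - \<theta> x)"
  proof -
    have "\<theta> x / x = 1 / (x + b)" using x by (simp add: \<theta>_def)
    moreover have "1 - \<theta> x = b / (x + b)" using x xb_pos[of x] by (simp add: \<theta>_def field_simps)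
    ultimately have "b * (C x * (\<theta> x / x)) = C x * (1 - \<theta> x)" by simp
    then show ?thesis
      unfolding times_divide_eq_right[symmetric] by simp
  qed
  ultimately show ?thesis
    by (simp add: C_def[abs_def])
qed

text \<open>On the open set \<open>Omega2 U\<close> the pressure is explicitly
  \<open>a * (y * S y - D * sqrt (S y))\<close>.\<close>

lemma F_gamma_has_deriv:
  assumes \<gamma>: "1 < \<gamma>" "\<gamma> \<le> 2" and H: "gamma_law \<gamma> H" and x: "x \<in> Omega2 U"
  shows "(F H U has_real_derivative G ((\<gamma> - 1) / \<gamma>) x) (at x)"
proof -
  define a where "a = (\<gamma> - 1) / \<gamma>"
  have eq: "F H U y = y - a * (y * S y - D * sqrt (S y)) + b / 2 - E + b * \<beta> / (2 * (y + b)\<^sup>2)"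
    if y: "y \<in> Omega2 U" for y
  proof -
    have "pressure_at H U y = a * (D * sqrt (S y)) * (y * sqrt (S y) / D - 1)"
      unfolding pressure_at_def a_def
      using pressure_gamma_law[OF \<gamma> H rest_density_pos[OF y] enthalpy_gt_1[OF y]] Omega2_simps[OF y]
      by (simp add: rest_density_eq enthalpy_eq)
    also have "\<dots> = a * (y * (sqrt (S y))\<^sup>2 - D * sqrt (S y))"
      using adm_simps(1) by (simp add: field_simps power2_eq_square)
    finally show ?thesis using Omega2_simps[OF y] by (simp add: F_eq)
  qed
  note x' = Omega2_simps[OF x]
  define s where "s = sqrt (S x)"
  have s: "s > 0" "S x = s\<^sup>2" using x' by (simp_all add: s_def)
  define u where "u = A x + C x * \<theta> x"
  have dS: "(S has_real_derivative 2 * u / x) (at x)"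
    and ds: "((\<lambda>x. sqrt (S x)) has_real_derivative u / (x * s)) (at x)"
    using has_deriv_S[OF x'(1)] has_deriv_sqrt_S[OF x'(1,2)] by (simp_all only: u_def s_def)
  note last = has_deriv_magnetic_term[OF x'(1)]
  have "((\<lambda>y. y - a * (y * S y - D * sqrt (S y)) + b / 2 - E + b * \<beta> / (2 * (y + b)\<^sup>2))
     has_real_derivative 1 - a * ((1 * S x + 2 * u / x * x) - D * (u / (x * s))) + 0 - 0
        + - C x * (1 - \<theta> x)) (at x)"
    by (intro DERIV_add DERIV_diff DERIV_cmult DERIV_mult DERIV_ident DERIV_const dS ds last)
  also have "1 - a * ((1 * S x + 2 * u / x * x) - D * (u / (x * s))) + 0 - 0 + - C x * (1 - \<theta> x) = G a x"
    using x'(1) by (simp add: G_def s_def u_def right_diff_distrib)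
  finally show ?thesis
    unfolding a_def[symmetric]
    by (rule has_field_derivative_transform_within_open[of _ _ _ "Omega2 U"])
       (use x eq in \<open>auto simp: Omega2_def\<close>)
qed

text \<open>The derivative of \<open>G a\<close> has the sign of \<open>Y k x - D\<close>, and
  \<open>Y k\<close> is nondecreasing since \<open>a \<le> 1 / 2\<close> gives
  \<open>k \<ge> 2\<close>. Comparing \<open>Y k y\<close> with \<open>D\<close> selects the
  alternative. For zero momentum \<open>G a\<close> is constant.\<close>

lemma G_shape:
  assumes a: "0 < a" "a \<le> 1 / 2" and y: "y \<in> Omega2 U"
  shows "antimono_on {xi_b U<..y} (G a) \<or> mono_on {y..} (G a)"
proof -
  define k where "k = 3 / a - 4"
  have k: "k \<ge> 2" using a by (simp add: k_def field_simps)
  define G' where "G' x = a / x\<^sup>2 * (x * R k x - D * T x / (S x * sqrt (S x)))" for x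
  have dG: "(G a has_real_derivative G' x) (at x)" if "x > xi_b U" for x
  proof -
    have "x \<in> Omega2 U" using that by (simp add: Omega2_def)
    then show ?thesis unfolding G'_def k_def
      using Omega2_simps[of x] a by (intro has_deriv_G) auto
  qed
  have ay: "y > xi_b U" using y by (simp add: Omega2_def)
  have anti: "antimono_on {xi_b U<..y} (G a)" if "\<And>x. xi_b U < x \<Longrightarrow> x \<le> y \<Longrightarrow> G' x \<le> 0"
  proof (rule monotone_onI)
    fix p q assume pq: "p \<in> {xi_b U<..y}" "q \<in> {xi_b U<..y}" "p \<le> q"
    show "G a p \<ge> G a q"
    proof (rule DERIV_nonpos_imp_nonincreasing[OF pq(3)])
      fix x assume "p \<le> x" "x \<le> q"
      then have "xi_b U < x" "x \<le> y" using pq by auto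
      then show "\<exists>d. (G a has_real_derivative d) (at x) \<and> d \<le> 0" using dG that by blast
    qed
  qed
  have mono: "mono_on {y..} (G a)" if "\<And>x. y \<le> x \<Longrightarrow> G' x \<ge> 0"
  proof (rule monotone_onI)
    fix p q assume pq: "p \<in> {y..}" "q \<in> {y..}" "p \<le> q"
    show "G a p \<le> G a q"
    proof (rule DERIV_nonneg_imp_nondecreasing[OF pq(3)])
      fix x assume "p \<le> x" "x \<le> q"
      then have "xi_b U < x" "y \<le> x" using pq ay by auto
      then show "\<exists>d. (G a has_real_derivative d) (at x) \<and> d \<ge> 0" using dG that by blast
    qed
  qed
  show ?thesis
  proof (cases "\<alpha> + \<beta> > 0")
    case False
    then have "\<alpha> = 0" "\<beta> = 0" using split_nonneg by auto
    then have zero: "A x = 0" "C x = 0" for x unfolding A_def C_def by simp_all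
    have "G' x = 0" for x by (simp add: G'_def R_def T_def zero)
    then show ?thesis using mono by simp
  next
    case True
    have sign: "G' x \<le> 0 \<longleftrightarrow> Y k x \<le> D" "G' x \<ge> 0 \<longleftrightarrow> D \<le> Y k x" if "x > xi_b U" for x
    proof -
      have x: "x > 0" "S x > 0" using Omega2_simps[of x] that by (simp_all add: Omega2_def)
      define c where "c = S x * sqrt (S x)"
      have c: "c > 0" using x by (simp add: c_def)
      have T: "T x > 0" using x True by (intro T_pos)
      define w where "w = a / x\<^sup>2 * (T x / c)"
      have "w > 0" using a x c T by (simp add: w_def)
      have "G' x = w * (Y k x - D)"
        unfolding G'_def Y_def w_def c_def[symmetric] using c T x by (simp add: divide_simps)
      then show "G' x \<le> 0 \<longleftrightarrow> Y k x \<le> D" "G' x \<ge> 0 \<longleftrightarrow> D \<le> Y k x"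
        using \<open>w > 0\<close> by (simp_all add: mult_le_0_iff zero_le_mult_iff)
    qed
    have Y_le: "Y k p \<le> Y k q" if "xi_b U < p" "p \<le> q" for p q
      using Omega2_simps[of p] that True k by (intro Y_mono) (simp_all add: Omega2_def)
    show ?thesis
    proof (cases "Y k y \<le> D")
      case True
      have "G' x \<le> 0" if "xi_b U < x" "x \<le> y" for x
        using Y_le[OF that] sign(1)[OF that(1)] True by linarith
      then show ?thesis by (intro disjI1 anti)
    next
      case False
      have "G' x \<ge> 0" if "y \<le> x" for x
        using Y_le[OF ay that] sign(2)[of x] False that ay by linarith
      then show ?thesis by (intro disjI2 mono)
    qed
  qed
qed

end

subsection \<open>Roots and convergence\<close>

text \<open>The Cauchy-Schwarz inequality makes the orthogonal part nonnegative. Without magnetic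
  field \<open>tau U\<close> vanishes, and the whole momentum may be counted as parallel.\<close>

lemma orthogonal_split_exists:
  assumes "U \<in> admissible"
  shows "\<exists>\<alpha> \<beta>. orthogonal_split U \<alpha> \<beta>"
proof (cases "mag U = 0")
  case True
  with assms have "orthogonal_split U ((norm (mom U))\<^sup>2) 0"
    by unfold_locales (simp_all add: tau_def)
  then show ?thesis by blast
next
  case False
  define \<alpha> where "\<alpha> = (tau U)\<^sup>2 / (norm (mag U))\<^sup>2"
  have "(tau U)\<^sup>2 \<le> (norm (mom U))\<^sup>2 * (norm (mag U))\<^sup>2"
    using Cauchy_Schwarz_ineq[of "mom U" "mag U"] by (simp add: tau_def power2_norm_eq_inner)
  then have "\<alpha> \<le> (norm (mom U))\<^sup>2" using False by (simp add: \<alpha>_def divide_le_eq)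
  with assms False have "orthogonal_split U \<alpha> ((norm (mom U))\<^sup>2 - \<alpha>)"
    by unfold_locales (simp_all add: \<alpha>_def)
  then show ?thesis by blast
qed

section \<open>Pressure bounds, the root of \<open>F\<close>, and the shape of
  \<open>F'\<close>\<close>

context orthogonal_split
begin

text \<open>Along the curve, density times enthalpy is \<open>x * S x\<close>, at most
  \<open>x\<close>. The upper bound makes \<open>F\<close> nonnegative far to the right.\<close>

lemma pressure_at_pos:
  assumes "general_eos H" "x \<in> Omega2 U"
  shows "pressure_at H U x > 0" "pressure_at H U x < x / 2"
proof -
  note x = Omega2_simps[OF assms(2)]
  note \<rho>h = rest_density_pos[OF assms(2)] enthalpy_gt_1[OF assms(2)]
  show "pressure_at H U x > 0"
    unfolding pressure_at_def by (rule pressure_works[OF assms(1) \<rho>h])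
  have "pressure_at H U x < rest_density U x * enthalpy U x / 2"
    unfolding pressure_at_def by (rule pressure_upper[OF assms(1) \<rho>h])
  also have "rest_density U x * enthalpy U x = x * S x"
    using x adm_simps(1) by (simp add: rest_density_eq enthalpy_eq)
  also have "x * S x / 2 \<le> x / 2" using S_le_1 x(1) by simp
  finally show "pressure_at H U x < x / 2" .
qed

text \<open>Condition (iii) on the equation of state bounds the derivative of the pressure along the
  curve by \<open>S + A + C \<theta>\<close>, and the remaining terms of \<open>F'\<close> cancel this bound exactly.\<close>

lemma F_deriv_pos:
  assumes eos: "general_eos H" and x: "x \<in> Omega2 U"
  shows "\<exists>d>0. (F H U has_real_derivative d) (at x)"
proof -
  note x' = Omega2_simps[OF x]
  define s where "s = sqrt (S x)"
  have s: "s > 0" "S x = s\<^sup>2" using x' by (simp_all add: s_def)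
  define u where "u = A x + C x * \<theta> x"
  have u: "u \<ge> 0" using A_C_nonneg[of x] theta_bounds[OF x'(1)] by (simp add: u_def)
  define s' where "s' = u / (x * s)"
  have s': "s' \<ge> 0" using u x' s by (simp add: s'_def)
  have ds: "((\<lambda>y. sqrt (S y)) has_real_derivative s') (at x)"
    using has_deriv_sqrt_S[OF x'(1,2)] by (simp only: u_def s_def s'_def)
  have dr: "((\<lambda>y. D * sqrt (S y)) has_real_derivative D * s') (at x)"
    by (intro DERIV_cmult ds)
  have dh: "((\<lambda>y. y * sqrt (S y) / D) has_real_derivative (1 * s + s' * x) / D) (at x)"
    unfolding s_def by (intro DERIV_cdivide DERIV_mult DERIV_ident ds)
  define r where "r = D * s"
  define h where "h = x * s / D"
  have rh: "r > 0" "h > 1"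
    using rest_density_pos[OF x] enthalpy_gt_1[OF x] x'
    by (simp_all add: rest_density_eq enthalpy_eq r_def h_def s_def)
  define p where "p = pressure H r h"
  have p: "p > 0" "H r p = h" using pressure_works[OF eos rh] by (simp_all add: p_def)
  define Hr where "Hr = deriv (\<lambda>r. H r p) r"
  define Hp where "Hp = deriv (\<lambda>q. H r q) p"
  have part: "Hr < 0" "h * (1 / r - Hp) < Hr" "Hp > 1 / r"
    using eos_partials[OF eos rh(1) p(1)] by (simp_all add: Hr_def Hp_def p(2))
  have "Hp > 0" using part(3) rh(1) by (meson less_trans zero_less_divide_1_iff)
  \<comment> \<open>Chain rule along the curve of density and enthalpy, with the coefficients from
    \<open>pressure_has_derivative\<close>.\<close>
  define p' where "p' = ((1 * s + s' * x) / D - Hr * (D * s')) / Hp"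
  have dp: "((\<lambda>y. pressure H (D * sqrt (S y)) (y * sqrt (S y) / D)) has_real_derivative p') (at x)"
  proof -
    have curve: "((\<lambda>y. (D * sqrt (S y), y * sqrt (S y) / D)) has_derivative
        (\<lambda>t. (D * s' * t, (1 * s + s' * x) / D * t))) (at x)"
      using dr dh unfolding has_field_derivative_def by (rule has_derivative_Pair)
    have "((\<lambda>y. pressure H (fst y) (snd y)) has_derivative (\<lambda>y. (snd y - Hr * fst y) / Hp))
        (at (D * sqrt (S x), x * sqrt (S x) / D))"
      using pressure_has_derivative[OF eos rh, folded p_def, folded Hr_def Hp_def]
      unfolding case_prod_beta' r_def h_def s_def .
    from has_derivative_compose[OF curve this]
    have "((\<lambda>y. pressure H (D * sqrt (S y)) (y * sqrt (S y) / D)) has_derivative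
        (\<lambda>t. ((1 * s + s' * x) / D * t - Hr * (D * s' * t)) / Hp)) (at x)"
      unfolding fst_conv snd_conv .
    moreover have "(\<lambda>t. ((1 * s + s' * x) / D * t - Hr * (D * s' * t)) / Hp) = (*) p'"
      by (simp add: p'_def fun_eq_iff diff_divide_distrib left_diff_distrib right_diff_distrib mult_ac)
    ultimately show ?thesis by (simp add: has_field_derivative_def)
  qed
  have p'_less: "p' < s\<^sup>2 + u"
  proof -
    have "(1 * s + s' * x) / D - Hr * (D * s') < (s\<^sup>2 + u) * Hp"
    proof -
      have rs': "D * s' \<ge> 0" using s' adm_simps(1) by simp
      have hx: "h * (D * s') = u" "h / r * (D * s') = s' * x / D" "s / D = s\<^sup>2 * (1 / r)"
        using s x'(1) adm_simps(1)
        by (simp_all add: h_def s'_def r_def power2_eq_square)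
      \<comment> \<open>Condition (iii) trades \<open>- Hr\<close> for
        \<open>h * (Hp - 1 / r)\<close>, whose \<open>1 / r\<close> part cancels the term
        \<open>s' * x / D\<close> in the derivative of the enthalpy.\<close>
      have "- Hr * (D * s') \<le> h * (Hp - 1 / r) * (D * s')"
        using part(2) rs' by (intro mult_right_mono) (simp_all add: algebra_simps)
      also have "\<dots> = u * Hp - s' * x / D"
        unfolding hx(1,2)[symmetric] by (simp add: algebra_simps)
      finally have "(1 * s + s' * x) / D - Hr * (D * s') \<le> u * Hp + s / D"
        by (simp add: add_divide_distrib)
      \<comment> \<open>Strictness comes from this term, since \<open>s'\<close> may vanish.\<close>
      moreover have "s / D < s\<^sup>2 * Hp"
        unfolding hx(3) using part(3) s(1) by (intro mult_strict_left_mono) simp_all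
      ultimately show ?thesis by (simp add: distrib_right)
    qed
    then show ?thesis unfolding p'_def using \<open>Hp > 0\<close> by (simp add: divide_less_eq)
  qed
  define d where "d = 1 - p' - C x * (1 - \<theta> x)"
  have "((\<lambda>y. y - pressure H (D * sqrt (S y)) (y * sqrt (S y) / D) + b / 2 - E + b * \<beta> / (2 * (y + b)\<^sup>2))
      has_real_derivative 1 - p' + 0 - 0 + - C x * (1 - \<theta> x)) (at x)"
    by (intro DERIV_add DERIV_diff DERIV_ident DERIV_const dp has_deriv_magnetic_term x')
  then have "(F H U has_real_derivative 1 - p' + 0 - 0 + - C x * (1 - \<theta> x)) (at x)"
    by (rule has_field_derivative_transform_within_open[of _ _ _ "Omega2 U"])
       (use x Omega2_simps in \<open>auto simp: Omega2_def F_eq pressure_at_def rest_density_eq enthalpy_eq\<close>)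
  moreover have "1 - p' + 0 - 0 + - C x * (1 - \<theta> x) > 0"
    using p'_less s(2) by (simp add: S_eq u_def algebra_simps)
  ultimately show ?thesis by blast
qed

text \<open>\<open>F\<close> is strictly increasing on \<open>Omega2 U\<close> and negative at
  \<open>xi_c U\<close>. The last clause turns the test \<open>F H U x \<le> 0\<close> into a
  position left of the root, as the choice of \<open>xi_d U\<close> requires.\<close>

lemma F_root:
  assumes eos: "general_eos H"
  shows "xi_star H U \<in> Omega2 U" "F H U (xi_star H U) = 0"
    and "x \<in> Omega2 U \<Longrightarrow> F H U x \<le> 0 \<Longrightarrow> x \<le> xi_star H U"
proof -
  have incr: "F H U x < F H U y" if "x \<in> Omega2 U" "x < y" for x y
  proof (rule DERIV_pos_imp_increasing[OF that(2)])
    fix z assume "x \<le> z"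
    then have "z \<in> Omega2 U" using that by (simp add: Omega2_def)
    from F_deriv_pos[OF eos this]
    show "\<exists>d. (F H U has_real_derivative d) (at z) \<and> d > 0" by blast
  qed
  define c where "c = xi_c U"
  \<comment> \<open>From \<open>2 * E\<close> on, the pressure bound \<open>X / 2\<close> leaves
    \<open>X - X / 2 - E \<ge> 0\<close>.\<close>
  define X where "X = max c (2 * E)"
  have c: "c \<in> Omega2 U" using xi_c_in_Omega2 by (simp add: c_def)
  then have up: "y \<in> Omega2 U" if "c \<le> y" for y using that by (simp add: Omega2_def)
  have low: "F H U c \<le> 0"
    using F_xi_c_neg pressure_at_pos(1)[OF eos xi_c_in_Omega2] by (simp add: c_def less_imp_le)
  have "F H U X \<ge> 0"
  proof -
    have X: "X \<in> Omega2 U" by (intro up) (simp add: X_def)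
    have "F H U X = X - pressure_at H U X + b / 2 - E + b * \<beta> / (2 * (X + b)\<^sup>2)"
      using X Omega2_simps by (intro F_eq) auto
    moreover have "b * \<beta> / (2 * (X + b)\<^sup>2) \<ge> 0" "b \<ge> 0" using split_nonneg by simp_all
    moreover have "X \<ge> 2 * E" by (simp add: X_def)
    ultimately show ?thesis using pressure_at_pos(2)[OF eos X] by argo
  qed
  moreover have "continuous_on {c..X} (F H U)"
  proof (intro continuous_at_imp_continuous_on ballI)
    fix z assume "z \<in> {c..X}"
    then show "isCont (F H U) z" using F_deriv_pos[OF eos up[of z]] DERIV_isCont by auto
  qed
  ultimately obtain z where z: "c \<le> z" "F H U z = 0"
    using IVT'[of "F H U" c 0 X] low by (auto simp: X_def)
  have "xi_star H U = z"
    unfolding xi_star_def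
  proof (rule the_equality)
    show "z \<in> Omega2 U \<and> F H U z = 0" using z up by simp
    fix y assume "y \<in> Omega2 U \<and> F H U y = 0"
    then have "\<not> y < z" "\<not> z < y" using incr[of y z] incr[of z y] z up[of z] by auto
    then show "y = z" by simp
  qed
  then show "xi_star H U \<in> Omega2 U" "F H U (xi_star H U) = 0" using z up by simp_all
  show "x \<le> xi_star H U" if "x \<in> Omega2 U" "F H U x \<le> 0"
    using incr[of "xi_star H U" x] that z up \<open>xi_star H U = z\<close> by force
qed

text \<open>In the unimodal case, a point left of the turning point satisfies the first alternative,
  any other point the second.\<close>

lemma deriv_shape_dichotomy:
  assumes "deriv_shape H U" "y \<in> Omega2 U"
  shows "antimono_on {xi_b U<..y} (deriv (F H U)) \<or> mono_on {y..} (deriv (F H U))"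
proof -
  have *: "{xi_b U<..y} \<subseteq> Omega2 U" "{y..} \<subseteq> Omega2 U" using assms(2) by (auto simp: Omega2_def)
  consider "mono_on (Omega2 U) (deriv (F H U))" | "antimono_on (Omega2 U) (deriv (F H U))"
    | z where "antimono_on {xi_b U<..z} (deriv (F H U))" "mono_on {z..} (deriv (F H U))"
    using assms(1) by (auto simp: deriv_shape_def)
  then show ?thesis
  proof cases
    case 3
    then show ?thesis
      by (cases "y \<le> z") (auto simp: monotone_on_def)
  qed (use * monotone_on_subset in blast)+
qed

text \<open>\<open>deriv (F H U)\<close> agrees with \<open>G a\<close> on the open half-line and so
  inherits its shape and its differentiability; the latter is what the quadratic rate asks
  for.\<close>

lemma gamma_deriv_dichotomy:
  assumes \<gamma>: "1 < \<gamma>" "\<gamma> \<le> 2" and H: "gamma_law \<gamma> H" and y: "y \<in> Omega2 U"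
  shows "antimono_on {xi_b U<..y} (deriv (F H U)) \<or> mono_on {y..} (deriv (F H U))"
    and "deriv (F H U) differentiable (at y)"
proof -
  define a where "a = (\<gamma> - 1) / \<gamma>"
  have a: "0 < a" "a \<le> 1 / 2" using \<gamma> by (simp_all add: a_def field_simps)
  have eq: "deriv (F H U) x = G a x" if "x \<in> Omega2 U" for x
    unfolding a_def by (rule DERIV_imp_deriv[OF F_gamma_has_deriv[OF \<gamma> H that]])
  have sub: "x \<in> Omega2 U" if "x \<in> {xi_b U<..y} \<union> {y..}" for x
    using that y by (auto simp: Omega2_def)
  show "antimono_on {xi_b U<..y} (deriv (F H U)) \<or> mono_on {y..} (deriv (F H U))"
    using G_shape[OF a y] eq[OF sub] by (auto simp: monotone_on_def)
  have "open (Omega2 U)" by (simp add: Omega2_def)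
  then have "(deriv (F H U) has_real_derivative
       a / y\<^sup>2 * (y * R (3 / a - 4) y - D * T y / (S y * sqrt (S y)))) (at y)"
    using eq y Omega2_simps[OF y] a
    by (intro has_field_derivative_transform_within_open[OF has_deriv_G, of y a "Omega2 U"]) auto
  then show "deriv (F H U) differentiable (at y)"
    using real_differentiable_def by blast
qed

end

text \<open>A general equation of state is merely differentiable, so its rate is stated under
  differentiability of \<open>F'\<close> at the root. The gamma law satisfies this by
  \<open>gamma_deriv_dichotomy\<close>.\<close>

theorem theorem3p7:
  fixes U :: conserved
    and H :: "real \<Rightarrow> real \<Rightarrow> real"
    and \<xi> :: "nat \<Rightarrow> real"
  assumes "U \<in> admissible"
    and "(\<exists>\<gamma>. 1 < \<gamma> \<and> \<gamma> \<le> 2 \<and> gamma_law \<gamma> H) \<or> (general_eos H \<and> deriv_shape H U)"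
    and "\<xi> 0 = xi_c U \<or> \<xi> 0 = (if F H U (xi_d U) \<le> 0 then xi_d U else xi_c U)"
    and "\<And>n. \<xi> (Suc n) = \<xi> n - F H U (\<xi> n) / deriv (F H U) (\<xi> n)"
  shows "(\<forall>n. \<xi> n \<in> Omega1 U \<and> rest_density U (\<xi> n) > 0 \<and> pressure_at H U (\<xi> n) > 0
              \<and> norm (velocity U (\<xi> n)) < 1)
    \<and> \<xi> \<longlonglongrightarrow> xi_star H U
    \<and> ((\<exists>\<gamma>. 1 < \<gamma> \<and> \<gamma> \<le> 2 \<and> gamma_law \<gamma> H)
         \<or> deriv (F H U) differentiable (at (xi_star H U))
       \<longrightarrow> quadratic_rate \<xi> (xi_star H U))"
proof -
  obtain \<alpha> \<beta> where "orthogonal_split U \<alpha> \<beta>"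
    using orthogonal_split_exists[OF assms(1)] by blast
  then interpret orthogonal_split U \<alpha> \<beta> .
  have eos: "general_eos H"
    using assms(2) gamma_law_general_eos by blast
  have shape: "antimono_on {xi_b U<..y} (deriv (F H U)) \<or> mono_on {y..} (deriv (F H U))"
    if "y > xi_b U" for y
    using assms(2) deriv_shape_dichotomy[of H y] gamma_deriv_dichotomy(1)[of _ H y] that
    by (auto simp: Omega2_def)
  have deriv: "(F H U has_real_derivative deriv (F H U) y) (at y)"
    and deriv_pos: "deriv (F H U) y > 0" if "y > xi_b U" for y
    using F_deriv_pos[OF eos, of y] that DERIV_imp_deriv by (auto simp: Omega2_def)
  note root = F_root[OF eos]
  have star: "xi_star H U > xi_b U" using root(1) by (simp add: Omega2_def)
  \<comment> \<open>Either choice of initial guess lies in \<open>Omega2 U\<close> and has a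
    nonpositive value of \<open>F\<close>, hence lies at or left of the root.\<close>
  have start: "\<xi> 0 \<in> Omega2 U" "\<xi> 0 \<le> xi_star H U"
  proof -
    have "F H U (xi_c U) \<le> 0"
      using F_xi_c_neg pressure_at_pos(1)[OF eos xi_c_in_Omega2] by (simp add: less_imp_le)
    then show "\<xi> 0 \<in> Omega2 U" "\<xi> 0 \<le> xi_star H U"
      using assms(3) root(3) xi_c_in_Omega2 xi_d_in_Omega2 by (auto split: if_splits)
  qed
  then have "\<xi> 0 > xi_b U" by (simp add: Omega2_def)
  note newton = newton_converges[OF deriv deriv_pos shape star root(2) this start(2) assms(4)]
  \<comment> \<open>No iterate falls below \<open>\<xi> 0\<close>, and \<open>Omega2 U\<close> is
    unbounded to the right; every physical constraint holds there.\<close>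
  have iterates: "\<xi> n \<in> Omega2 U" for n
    using newton(1) \<open>\<xi> 0 > xi_b U\<close> less_le_trans by (auto simp: Omega2_def)
  have "norm (velocity U (\<xi> n)) < 1" for n
  proof (rule power2_less_imp_less)
    show "(norm (velocity U (\<xi> n)))\<^sup>2 < 1\<^sup>2"
      using Omega2_simps[OF iterates[of n]] by (simp add: norm_velocity)
  qed simp
  moreover have "quadratic_rate \<xi> (xi_star H U)" if "deriv (F H U) differentiable (at (xi_star H U))"
    by (rule newton_quadratic_rate[OF deriv that deriv_pos[OF star] star root(2) newton(2) assms(4)])
  ultimately show ?thesis
    using newton(2) Omega2_simps(4)[OF iterates] rest_density_pos[OF iterates]
      pressure_at_pos(1)[OF eos iterates] gamma_deriv_dichotomy(2)[OF _ _ _ root(1)]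
    by blast
qed

end
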